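(* Let $\mathcal{L}:x+y-z=0$ be Schur's equation. There is an absolute constant $c>0$ such that for every real $\varepsilon\in(0,1]$, $d(\mathcal{L},\varepsilon)\ge c\varepsilon$, i.e. $d(\mathcal{L},\varepsilon)=\Omega(\varepsilon)$.
   Context: For a prime $p$, a set $A\subseteq\mathbb{F}_p$ is solution-free for $\mathcal{L}$ if there are no pairwise distinct $x,y,z\in A$ with $x+y-z=0$ in $\mathbb{F}_p$. The Cayley graph $\mathrm{Cay}_{\mathbb{F}_p}(A)$ is the digraph on $\mathbb{F}_p$ with an arc $\vec{uv}$ iff $v-u\in A$; $\alpha$ of a digraph is the independence number of its underlying undirected graph. $D(\mathcal{L},\varepsilon,p)$ is the maximum size of a solution-free set $A$ of $\mathcal{L}$ in $\mathbb{F}_p$ with $\alpha(\mathrm{Cay}_{\mathbb{F}_p}(A))\le\varepsilon p$, and $d(\mathcal{L},\varepsilon):=\limsup_{p\to\infty,\ p\text{ prime}} D(\mathcal{L},\varepsilon,p)/p$. *)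

theory Defs
  imports
    "HOL-Analysis.Analysis"
    "HOL-Number_Theory.Residues"
    "Graph_Theory.Digraph_Component"
begin

text \<open>The field with \<open>p\<close> elements is \<open>residue_ring (int p)\<close>, whose carrier is \<open>{0..p - 1}\<close>.\<close>

definition schur_solution_free :: "nat \<Rightarrow> int set \<Rightarrow> bool" where
  "schur_solution_free p A \<longleftrightarrow>
     (let F = residue_ring (int p) in
        A \<subseteq> carrier F \<and>
        \<not> (\<exists>x\<in>A. \<exists>y\<in>A. \<exists>z\<in>A. x \<noteq> y \<and> y \<noteq> z \<and> x \<noteq> z \<and>
              x \<oplus>\<^bsub>F\<^esub> y \<ominus>\<^bsub>F\<^esub> z = \<zero>\<^bsub>F\<^esub>))"

definition cayley_digraph :: "nat \<Rightarrow> int set \<Rightarrow> int pair_pre_digraph" where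
  "cayley_digraph p A =
     (let F = residue_ring (int p) in
        \<lparr> pverts = carrier F,
          parcs = {(u, v). u \<in> carrier F \<and> v \<in> carrier F \<and> v \<ominus>\<^bsub>F\<^esub> u \<in> A} \<rparr>)"

text \<open>
  The underlying undirected graph is simple: a loop does not prevent its vertex from being in
  an independent set. This matters because \<open>0\<close> may belong to a solution-free set \<open>A\<close>, and then
  every vertex of the Cayley digraph carries a loop.
\<close>
definition independent_set :: "('a, 'b) pre_digraph \<Rightarrow> 'a set \<Rightarrow> bool" where
  "independent_set G S \<longleftrightarrow>
     S \<subseteq> verts G \<and>
     (\<forall>u\<in>S. \<forall>v\<in>S. u \<noteq> v \<longrightarrow> \<not> (u \<rightarrow>\<^bsub>with_proj (mk_symmetric G)\<^esub> v))"

definition independence_number :: "('a, 'b) pre_digraph \<Rightarrow> nat" where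
  "independence_number G = Max {card S | S. independent_set G S}"

text \<open>
  The supremum is over a finite set of naturals, so it is a maximum, except that it is \<open>0\<close>
  when no admissible set \<open>A\<close> exists (for instance when \<open>\<epsilon> * p < 1\<close>).
\<close>
definition schur_D :: "real \<Rightarrow> nat \<Rightarrow> nat" where
  "schur_D \<epsilon> p =
     Sup {card A | A. schur_solution_free p A \<and>
            real (independence_number (with_proj (cayley_digraph p A))) \<le> \<epsilon> * real p}"

definition schur_d :: "real \<Rightarrow> ereal" where
  "schur_d \<epsilon> =
     Limsup (inf sequentially (principal {p. prime p})) (\<lambda>p. ereal (real (schur_D \<epsilon> p) / real p))"

end

theory Submission
  imports Defs
begin

text \<open>
  Fix a prime \<open>q\<close> of order \<open>1 / \<epsilon>\<close>. In \<open>\<int>\<^sub>q\<^sup>3\<close> take the vectors \<open>t (y, y\<^sup>2, y\<^sup>3)\<close> with \<open>y \<noteq> 0\<close> and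
  \<open>t\<close> in the middle third of \<open>\<int>\<^sub>q\<close>. Since points of the moment curve over distinct nonzero \<open>y\<close> are
  linearly independent, a Schur triple would have equal \<open>y\<close>, which the choice of \<open>t\<close> forbids. There are
  about \<open>q\<^sup>2 / 3\<close> such vectors. A cubic has at most three roots, so, after \<open>t\<close> is weighted by a
  difference of two intervals, all nontrivial Fourier coefficients are smaller than the trivial one
  by a factor of order \<open>q\<close>, and sets independent in the Cayley graph have \<open>O(q\<^sup>2)\<close> elements.
  Thus both densities are of order \<open>1 / q\<close>.

  The example is transferred to \<open>\<int>\<^sub>p\<close> along \<open>x \<mapsto> (M x / p, M\<^sup>2 x / p, M\<^sup>3 x / p) / M\<close> into the torus,
  where \<open>M = 4 q\<close>: the set consists of all \<open>x\<close> whose image is within \<open>1 / M\<close> of a chosen vector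
  divided by \<open>q\<close>. The cells of side \<open>1 / M\<close> in the torus correspond to the first three base-\<open>M\<close>
  digits of \<open>x / p\<close>, hence to intervals of length \<open>p / M\<^sup>3\<close>, so densities change by constant factors only.
  Finally, a Chebyshev-type argument shows that suitable \<open>q\<close> are available at every scale.
\<close>

section \<open>Primes between consecutive powers of four\<close>

text \<open>This is integrality of \<open>Lcm {1..N}\<close> times the entries of the Leibniz harmonic triangle.\<close>

lemma binomial_dvd_Lcm_aux:
  assumes "j < n" "n \<le> N"
  shows "Suc j * (n choose Suc j) dvd Lcm {1..N}"
  using assms
proof (induction j arbitrary: n)
  case 0
  then show ?case by (auto intro: dvd_Lcm)
next
  case (Suc j)
  then obtain m where n: "n = Suc m" and jm: "j < m" by (cases n) auto
  define B where "B = (m choose Suc j)"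
  define C where "C = (Suc m choose Suc (Suc j))"
  obtain a where a: "Lcm {1..N} = Suc j * B * a"
    using Suc.IH[of m] Suc.prems n jm by (auto simp: B_def dvd_def)
  obtain b where b: "Lcm {1..N} = Suc j * (Suc m choose Suc j) * b"
    using Suc.IH[of "Suc m"] Suc.prems n jm by (auto simp: dvd_def)
  have c1: "Suc (Suc j) * C = Suc m * B"
    unfolding C_def B_def by (rule Suc_times_binomial)
  have c2: "(m - j) * (Suc m choose Suc j) = Suc m * B"
    unfolding B_def using binomial_absorb_comp[of "Suc m" "Suc j"] jm by simp
  have Bpos: "B > 0" unfolding B_def using jm by simp
  \<comment> \<open>Here \<open>a\<close> and \<open>b\<close> are \<open>Lcm {1..N}\<close> times
    the reciprocals of \<open>Suc j * B\<close> and \<open>Suc j * (Suc m choose Suc j)\<close>.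
    These reciprocals are neighbours in the harmonic triangle, and their difference is the next
    entry, the reciprocal of \<open>Suc (Suc j) * C\<close>.\<close>
  have "int (Suc (Suc j) * C) * (int a - int b) = int (Lcm {1..N})"
  proof -
    obtain d where d: "m = j + d" using jm by (metis less_imp_add_positive)
    have "Suc j * B * a * d = Suc j * (Suc m choose Suc j) * b * d"
      using a b by metis
    also have "\<dots> = Suc j * (d * (Suc m choose Suc j)) * b" by (simp only: mult_ac)
    also have "\<dots> = Suc j * (Suc m * B) * b" using c2 d by simp
    finally have "(Suc j * B) * (a * d) = (Suc j * B) * (Suc m * b)" by (simp only: mult_ac)
    then have "a * d = Suc m * b" using Bpos by (simp only: mult_cancel1) simp
    then have e: "int a * int d = int (Suc m) * int b" by (metis of_nat_mult)
    have "int (Suc j * B * a) = int B * (int (Suc m) * int a - int a * int d)"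
      by (simp add: d algebra_simps)
    also have "\<dots> = int (Suc m * B) * (int a - int b)"
      unfolding e by (simp add: algebra_simps)
    finally show ?thesis using c1 a by metis
  qed
  then show ?case unfolding n C_def by (metis dvd_triv_left int_dvd_int_iff)
qed

lemma binomial_dvd_Lcm:
  assumes "k \<le> n" "0 < k"
  shows "n choose k dvd Lcm {1..n}"
proof -
  obtain j where "k = Suc j" using assms(2) by (cases k) auto
  then show ?thesis using binomial_dvd_Lcm_aux[of j n n] assms by (metis Suc_le_lessD dvd_mult_right order_refl)
qed

text \<open>The multiplicity of a prime in an lcm is the maximum of its multiplicities, so one of
  the arguments already attains it. For the empty set, \<open>Lcm\<close> is 1 and
  \<open>k > 0\<close> excludes divisibility.\<close>

lemma prime_power_dvd_Lcm:
  fixes A :: "nat set"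
  assumes "prime r" "finite A" "r ^ k dvd Lcm A" "k > 0"
  shows "\<exists>a\<in>A. r ^ k dvd a"
  using assms(2,3)
proof (induction A rule: finite_induct)
  case empty
  then show ?case using assms by (simp add: prime_nat_iff)
next
  case (insert a A)
  show ?case
  proof (cases "r ^ k dvd a \<or> a = 0 \<or> Lcm A = 0")
    case True
    then show ?thesis using insert by auto
  next
    case False
    have "k \<le> multiplicity r (lcm a (Lcm A))"
      using insert.prems False assms by (intro multiplicity_geI) (auto simp: prime_nat_iff lcm_eq_0_iff)
    also have "\<dots> = max (multiplicity r a) (multiplicity r (Lcm A))"
      using False assms by (intro multiplicity_lcm) auto
    finally have "r ^ k dvd a \<or> r ^ k dvd Lcm A"
      by (auto simp: max_def multiplicity_dvd' split: if_splits)
    then show ?thesis using insert by auto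
  qed
qed

text \<open>The binomial coefficient divides \<open>Lcm {1..n}\<close>, so the prime power divides
  one of the numbers \<open>1..n\<close> and cannot exceed it.\<close>

lemma prime_power_dvd_binomial_le:
  assumes "prime r" "k \<le> n" "0 < k" "r ^ e dvd (n choose k)"
  shows "r ^ e \<le> n"
proof (cases "e = 0")
  case False
  have "r ^ e dvd Lcm {1..n}" using assms binomial_dvd_Lcm dvd_trans by blast
  then obtain a where "a \<in> {1..n}" "r ^ e dvd a"
    using prime_power_dvd_Lcm[of r "{1..n}" e] False assms by auto
  then show ?thesis by (auto dest: dvd_imp_le)
qed (use assms in auto)

section \<open>Bounds for primorials and central binomial coefficients\<close>

definition primorial :: "nat \<Rightarrow> nat" where
  "primorial n = \<Prod>{r. prime r \<and> r \<le> n}"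

lemma prod_primes_dvd:
  fixes n :: nat
  assumes "finite A" "\<And>r. r \<in> A \<Longrightarrow> prime r \<and> r dvd n"
  shows "\<Prod>A dvd n"
  using assms
proof (induction A rule: finite_induct)
  case (insert a A)
  have "coprime a (\<Prod>A)"
    using insert by (intro prod_coprime_right) (metis insertCI primes_coprime)
  then show ?case using insert by (simp add: divides_mult)
qed simp

text \<open>Every prime between \<open>n\<close> and \<open>2 * n\<close> divides the factorial of
  \<open>2 * n\<close> but not that of \<open>n\<close>. Hence the product of these primes divides
  the central binomial coefficient, which is at most \<open>4 ^ n\<close>.\<close>

lemma primorial_double: "primorial (2 * n) \<le> primorial n * 4 ^ n"
proof -
  have split: "{r. prime r \<and> r \<le> 2 * n} = {r. prime r \<and> r \<le> n} \<union> {r. prime r \<and> n < r \<and> r \<le> 2 * n}"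
    by auto
  have fin: "finite {r. prime r \<and> n < r \<and> r \<le> 2 * n}" "finite {r::nat. prime r \<and> r \<le> n}"
    by (auto intro: finite_subset[of _ "{..2*n}"])
  have "\<Prod>{r. prime r \<and> n < r \<and> r \<le> 2 * n} dvd (2 * n choose n)"
  proof (rule prod_primes_dvd[OF fin(1)])
    fix r assume "r \<in> {r. prime r \<and> n < r \<and> r \<le> 2 * n}"
    then have r: "prime r" "n < r" "r \<le> 2 * n" by auto
    have "fact n * fact (2 * n - n) * (2 * n choose n) = (fact (2 * n) :: nat)"
      by (rule binomial_fact_lemma) simp
    moreover have "r dvd fact (2 * n)" using r by (simp add: prime_dvd_fact_iff)
    moreover have "\<not> r dvd fact n" using r by (simp add: prime_dvd_fact_iff)
    ultimately show "prime r \<and> r dvd (2 * n choose n)"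
      using r by (metis add_diff_cancel_left' mult_2 prime_dvd_mult_iff)
  qed
  then have "\<Prod>{r. prime r \<and> n < r \<and> r \<le> 2 * n} \<le> (2 * n choose n)"
    by (rule dvd_imp_le) simp
  also have "\<dots> \<le> 2 ^ (2 * n)" by (rule binomial_le_pow2)
  also have "\<dots> = (4::nat) ^ n" by (simp add: power_mult)
  finally show ?thesis
    unfolding primorial_def split using fin by (subst prod.union_disjoint) auto
qed

lemma primorial_power2: "primorial (2 ^ k) \<le> 4 ^ (2 ^ k)"
proof (induction k)
  case 0
  have "{r::nat. prime r \<and> r \<le> 1} = {}" by (auto dest: prime_gt_1_nat)
  then have "primorial (2 ^ 0) = 1" unfolding primorial_def by (simp only: power_0 prod.empty)
  then show ?case by simp
next
  case (Suc k)
  have "primorial (2 ^ Suc k) \<le> primorial (2 ^ k) * 4 ^ (2 ^ k)"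
    using primorial_double[of "2 ^ k"] by simp
  also have "\<dots> \<le> 4 ^ (2 ^ k) * 4 ^ (2 ^ k)" using Suc by simp
  finally show ?case by (simp add: mult_2 power_add)
qed

text \<open>Each prime up to \<open>s\<close> contributes a prime power of at most
  \<open>2 * n\<close>, and there are at most \<open>s\<close> such primes. A prime above
  \<open>s\<close> has a square above \<open>2 * n\<close>, hence occurs only once, and by the first
  assumption it is at most \<open>m\<close>.\<close>

lemma central_binomial_le:
  assumes "\<And>r. prime r \<Longrightarrow> r \<le> 2 * n \<Longrightarrow> r \<le> m" "s\<^sup>2 = 2 * n" "n > 0"
  shows "(2 * n choose n) \<le> (2 * n) ^ s * primorial m"
proof -
  define D where "D = (2 * n choose n)"
  have D0: "D > 0" by (simp add: D_def)
  let ?f = "\<lambda>r. r ^ multiplicity r D"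
  have le: "?f r \<le> 2 * n" if "r \<in> prime_factors D" for r
    using that assms(3) unfolding D_def
    by (intro prime_power_dvd_binomial_le[where k = n]) (auto simp: multiplicity_dvd)
  have rle: "r \<le> 2 * n" if "r \<in> prime_factors D" for r
    using prime_power_dvd_binomial_le[of r n "2 * n" 1] that assms(3) by (auto simp: D_def)
  define P where "P = {r \<in> prime_factors D. r \<le> s}"
  define Q where "Q = {r \<in> prime_factors D. r > s}"
  have "D = (\<Prod>r\<in>prime_factors D. ?f r)"
    using D0 by (simp add: prod_prime_factors)
  also have "prime_factors D = P \<union> Q" by (auto simp: P_def Q_def)
  also have "(\<Prod>r\<in>P \<union> Q. ?f r) = (\<Prod>r\<in>P. ?f r) * (\<Prod>r\<in>Q. ?f r)"
    by (rule prod.union_disjoint) (auto simp: P_def Q_def)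
  also have "(\<Prod>r\<in>P. ?f r) \<le> (\<Prod>r\<in>P. 2 * n)"
    using le by (intro prod_mono) (auto simp: P_def)
  also have "(\<Prod>r\<in>P. 2 * n) = (2 * n) ^ card P" by simp
  also have "\<dots> \<le> (2 * n) ^ s"
  proof -
    have "P \<subseteq> {1..s}" by (auto simp: P_def Suc_le_eq dest!: in_prime_factors_imp_prime intro: prime_gt_0_nat)
    then have "card P \<le> s" using card_mono[of "{1..s}" P] by simp
    then show ?thesis using assms(3) by (intro power_increasing) auto
  qed
  also have "(\<Prod>r\<in>Q. ?f r) \<le> \<Prod>Q"
  proof (rule prod_mono)
    fix r assume r: "r \<in> Q"
    then have pr: "r \<in> prime_factors D" "s < r" by (auto simp: Q_def)
    have "multiplicity r D \<le> 1"
    proof (rule ccontr)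
      assume "\<not> multiplicity r D \<le> 1"
      then have "r\<^sup>2 \<le> ?f r" using pr by (intro power_increasing) (auto dest: prime_gt_0_nat)
      then have "r\<^sup>2 \<le> s\<^sup>2" using le[OF pr(1)] assms(2) by simp
      then show False using pr(2) by (simp add: power_mono_iff)
    qed
    then have "?f r \<le> r ^ 1" using pr by (intro power_increasing) (auto dest: prime_gt_0_nat)
    then show "0 \<le> ?f r \<and> ?f r \<le> r" by simp
  qed
  also have "\<Prod>Q \<le> primorial m"
    unfolding primorial_def
  proof (rule dvd_imp_le[OF prod_dvd_prod_subset])
    show "finite {r. prime r \<and> r \<le> m}" by (auto intro: finite_subset[of _ "{..m}"])
    show "Q \<subseteq> {r. prime r \<and> r \<le> m}" using rle assms(1) by (auto simp: Q_def)
    show "0 < \<Prod>{r. prime r \<and> r \<le> m}" by (auto intro: prod_pos dest: prime_gt_0_nat)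
  qed
  finally show ?thesis by (simp add: D_def)
qed

text \<open>Without such a prime, \<open>central_binomial_le\<close> makes the central binomial
  coefficient smaller than its lower bound \<open>4 ^ n / (2 * n)\<close>. Since all quantities are
  bounded by powers of 4, it suffices to compare exponents; at \<open>j = 5\<close> the final
  comparison reads 390 < 1024.\<close>

lemma prime_between_powers_of_4:
  assumes "j \<ge> 5"
  shows "\<exists>r::nat. prime r \<and> 4 ^ j < r \<and> r \<le> 4 ^ Suc j"
proof (rule ccontr)
  assume "\<not> ?thesis"
  then have none: "\<And>r::nat. prime r \<Longrightarrow> r \<le> 4 ^ Suc j \<Longrightarrow> r \<le> 4 ^ j" by (meson not_le)
  define n :: nat where "n = 2 * 4 ^ j"
  have n2: "2 * n = 4 ^ Suc j" by (simp add: n_def)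
  have "real (4 ^ n) \<le> real ((2 * n) * (2 * n choose n))"
    using central_binomial_lower_bound[of n] by (simp add: n_def divide_le_eq mult.commute)
  then have "4 ^ n \<le> (2 * n) * (2 * n choose n)"
    by (simp only: of_nat_le_iff)
  also have "(2 * n choose n) \<le> (2 * n) ^ (2 ^ Suc j) * primorial (4 ^ j)"
  proof (rule central_binomial_le)
    show "r \<le> 4 ^ j" if "prime r" "r \<le> 2 * n" for r using none that n2 by simp
    \<comment> \<open>A power of four is a perfect square, which gives an integral cutoff
      \<open>s\<close>.\<close>
    show "(2 ^ Suc j)\<^sup>2 = 2 * n"
      unfolding n2 power2_eq_square power_mult_distrib[symmetric] by simp
  qed (simp add: n_def)
  also have "primorial (4 ^ j) \<le> 4 ^ (4 ^ j)"
    using primorial_power2[of "2 * j"] by (simp add: power_mult)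
  finally have "4 ^ n \<le> 2 * n * ((2 * n) ^ (2 ^ Suc j) * 4 ^ (4 ^ j))" by simp
  also have "\<dots> = (4::nat) ^ (Suc j + Suc j * 2 ^ Suc j + 4 ^ j)"
    unfolding n2 by (simp only: power_add power_mult mult.assoc)
  finally have "n \<le> Suc j + Suc j * 2 ^ Suc j + 4 ^ j"
    by (rule power_le_imp_le_exp[rotated]) simp
  then have "4 ^ j \<le> Suc j + Suc j * 2 ^ Suc j" by (simp add: n_def)
  moreover have "Suc j + Suc j * 2 ^ Suc j < 4 ^ j"
    using assms
  proof (induction j rule: dec_induct)
    case (step i)
    have "2 ^ i \<ge> (1::nat)" by simp
    have "Suc (Suc i) + Suc (Suc i) * 2 ^ Suc (Suc i) \<le> 4 * (Suc i + Suc i * 2 ^ Suc i)"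
      by (simp add: algebra_simps)
    also have "\<dots> < 4 * 4 ^ i" using step by simp
    finally show ?case by simp
  qed simp
  ultimately show False by simp
qed

section \<open>Fourier analysis on triples of residues\<close>

definition echar :: "int \<Rightarrow> int \<Rightarrow> complex" where
  "echar q k = cis (2 * pi * of_int k / of_int q)"

lemma echar_0 [simp]: "echar q 0 = 1"
  by (simp add: echar_def)

lemma echar_add: "echar q (a + b) = echar q a * echar q b"
  by (simp add: echar_def cis_mult ring_distribs add_divide_distrib)

lemma echar_minus: "echar q (- a) = cnj (echar q a)"
  by (simp add: echar_def cis_cnj)

lemma norm_echar [simp]: "norm (echar q a) = 1"
  by (simp add: echar_def)

lemma echar_eq_1_iff:
  assumes "q > 0"
  shows "echar q k = 1 \<longleftrightarrow> q dvd k"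
proof
  assume "echar q k = 1"
  then have "cos (2 * pi * of_int k / of_int q) = 1"
    by (simp add: echar_def complex_eq_iff)
  then obtain n :: int where "2 * pi * of_int k / of_int q = of_int n * 2 * pi"
    unfolding cos_one_2pi_int by blast
  then have "real_of_int k = of_int (n * q)" using assms by (simp add: field_simps)
  then have "k = n * q" by (simp only: of_int_eq_iff)
  then show "q dvd k" by simp
next
  assume "q dvd k"
  then obtain n where "k = q * n" by blast
  then have "2 * pi * of_int k / of_int q = 2 * pi * of_int n" using assms by simp
  then show "echar q k = 1" by (simp only: echar_def cis_multiple_2pi Ints_of_int)
qed

lemma echar_cong:
  assumes "q > 0" "[a = b] (mod q)"
  shows "echar q a = echar q b"
proof -
  have "echar q (a - b) = 1" using assms by (simp add: echar_eq_1_iff cong_iff_dvd_diff)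
  then show ?thesis using echar_add[of q "a - b" b] by simp
qed

lemma echar_power: "echar q (a * int n) = echar q a ^ n"
  by (induction n) (auto simp: ring_distribs echar_add)

text \<open>Orthogonality of characters: a full geometric sum over a root of unity vanishes unless
  the ratio is 1.\<close>

lemma sum_echar:
  assumes "q > 0"
  shows "(\<Sum>k\<in>{0..<q}. echar q (k * a)) = (if q dvd a then of_int q else 0)"
proof -
  have "(\<Sum>k\<in>{0..<q}. echar q (k * a)) = (\<Sum>n<nat q. echar q a ^ n)"
    by (rule sum.reindex_bij_witness[of _ int nat]) (auto simp: mult.commute simp flip: echar_power)
  also have "\<dots> = (if q dvd a then of_int q else 0)"
  proof (cases "q dvd a")
    case True
    then show ?thesis using assms by (simp add: echar_eq_1_iff[THEN iffD2])
  next
    case False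
    then have "echar q a \<noteq> 1" using assms by (simp add: echar_eq_1_iff)
    moreover have "echar q a ^ nat q = 1"
      using assms by (simp add: echar_eq_1_iff flip: echar_power)
    ultimately show ?thesis using False by (simp add: geometric_sum)
  qed
  finally show ?thesis .
qed

type_synonym vec3 = "int \<times> int \<times> int"

fun dot3 :: "vec3 \<Rightarrow> vec3 \<Rightarrow> int" where
  "dot3 (a1, a2, a3) (b1, b2, b3) = a1 * b1 + a2 * b2 + a3 * b3"

fun cong3 :: "int \<Rightarrow> vec3 \<Rightarrow> vec3 \<Rightarrow> bool" where
  "cong3 q (a1, a2, a3) (b1, b2, b3) \<longleftrightarrow> [a1 = b1] (mod q) \<and> [a2 = b2] (mod q) \<and> [a3 = b3] (mod q)"

definition box3 :: "int \<Rightarrow> vec3 set" where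
  "box3 q = {0..<q} \<times> {0..<q} \<times> {0..<q}"

definition moment :: "int \<Rightarrow> int \<Rightarrow> vec3" where
  "moment t y = (t * y, t * y ^ 2, t * y ^ 3)"

lemma finite_box3 [simp]: "finite (box3 q)"
  by (simp add: box3_def)

lemma card_box3: "card (box3 q) = nat q ^ 3"
  by (simp add: box3_def card_cartesian_product power3_eq_cube)

lemma dot3_diff: "dot3 x (a - b) = dot3 x a - dot3 x b"
  by (cases x; cases a; cases b) (simp add: algebra_simps)

lemma dot3_moment: "dot3 x (moment t y) = t * dot3 x (moment 1 y)"
  by (cases x) (simp add: moment_def algebra_simps)

lemma sum_echar_dot3:
  assumes "q > 0"
  shows "(\<Sum>x\<in>box3 q. echar q (dot3 x d)) = (if cong3 q d 0 then of_int q ^ 3 else 0)"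
proof -
  obtain d1 d2 d3 where d: "d = (d1, d2, d3)" by (cases d)
  have "(\<Sum>x\<in>box3 q. echar q (dot3 x d)) =
      (\<Sum>a\<in>{0..<q}. echar q (a * d1)) * ((\<Sum>a\<in>{0..<q}. echar q (a * d2)) * (\<Sum>a\<in>{0..<q}. echar q (a * d3)))"
    unfolding box3_def d sum.cartesian_product' dot3.simps echar_add mult.assoc
    by (simp only: fst_conv snd_conv sum_distrib_left[symmetric] sum_distrib_right[symmetric])
  also have "\<dots> = (if cong3 q d 0 then of_int q ^ 3 else 0)"
    using assms by (simp add: sum_echar d cong_0_iff zero_prod_def power3_eq_cube)
  finally show ?thesis .
qed

text \<open>From four solutions, the divided differences of first (\<open>d1\<close>), second
  (\<open>d2\<close>) and third order are divisible by \<open>q\<close>, because distinct solutions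
  differ by units. The third order one is \<open>c\<close>; then \<open>b\<close> and
  \<open>a\<close> follow backwards.\<close>

lemma cubic_fiber_le_3:
  assumes "prime q" "\<not> cong3 q (a, b, c) 0"
  shows "card {y \<in> {1..<q}. [a * y + b * y ^ 2 + c * y ^ 3 = s] (mod q)} \<le> 3"
proof (rule ccontr)
  let ?f = "\<lambda>y. a * y + b * y ^ 2 + c * y ^ 3"
  let ?Y = "{y \<in> {1..<q}. [?f y = s] (mod q)}"
  assume "\<not> card ?Y \<le> 3"
  then have "4 \<le> card ?Y" by simp
  then obtain Z where Z: "Z \<subseteq> ?Y" "card Z = 4" "finite Z" by (rule obtain_subset_with_card_n)
  then obtain zs where "set zs = Z" "distinct zs" "length zs = 4"
    using finite_distinct_list distinct_card by metis
  then obtain y1 y2 y3 y4 where y: "Z = {y1, y2, y3, y4}" "distinct [y1, y2, y3, y4]"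
    by (auto simp: length_Suc_conv numeral_eq_Suc)
  have cancel: "q dvd k" if "q dvd (u - v) * k" "u \<in> Z" "v \<in> Z" "u \<noteq> v" for u v k
  proof -
    have "\<not> q dvd (u - v)"
    proof
      assume "q dvd (u - v)"
      then have "[u = v] (mod q)" by (simp add: cong_iff_dvd_diff)
      moreover have "u \<in> {1..<q}" "v \<in> {1..<q}" using that Z by auto
      ultimately show False using that by (auto simp: cong_less_imp_eq_int)
    qed
    then show ?thesis using that assms(1) prime_dvd_mult_iff by blast
  qed
  have d1: "q dvd a + b * (u + v) + c * (u\<^sup>2 + u * v + v\<^sup>2)" if "u \<in> Z" "v \<in> Z" "u \<noteq> v" for u v
  proof (rule cancel[OF _ that])
    have "[?f u = ?f v] (mod q)" using that Z by (auto intro: cong_trans cong_sym)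
    then have "q dvd ?f u - ?f v" by (simp add: cong_iff_dvd_diff)
    also have "?f u - ?f v = (u - v) * (a + b * (u + v) + c * (u\<^sup>2 + u * v + v\<^sup>2))"
      by (simp add: algebra_simps power2_eq_square power3_eq_cube)
    finally show "q dvd (u - v) * (a + b * (u + v) + c * (u\<^sup>2 + u * v + v\<^sup>2))" .
  qed
  have d2: "q dvd b + c * (u + v + w)" if "u \<in> Z" "v \<in> Z" "w \<in> Z" "distinct [u, v, w]" for u v w
  proof (rule cancel[of v w])
    have "q dvd (a + b * (u + v) + c * (u\<^sup>2 + u * v + v\<^sup>2)) - (a + b * (u + w) + c * (u\<^sup>2 + u * w + w\<^sup>2))"
      using that by (intro dvd_diff d1) auto
    also have "\<dots> = (v - w) * (b + c * (u + v + w))"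
      by (simp add: algebra_simps power2_eq_square)
    finally show "q dvd (v - w) * (b + c * (u + v + w))" .
  qed (use that in auto)
  have c: "q dvd c"
  proof (rule cancel[of y3 y4])
    have "q dvd (b + c * (y1 + y2 + y3)) - (b + c * (y1 + y2 + y4))"
      using y by (intro dvd_diff d2) auto
    also have "\<dots> = (y3 - y4) * c" by (simp add: algebra_simps)
    finally show "q dvd (y3 - y4) * c" .
  qed (use y in auto)
  have b: "q dvd b" using d2[of y1 y2 y3] y c by (auto simp: dvd_add_left_iff)
  have "q dvd a" using d1[of y1 y2] y b c by (auto simp: dvd_add_left_iff)
  then show False using assms b c by (simp add: zero_prod_def cong_0_iff)
qed

lemma dvd_diff_iff_eq:
  fixes a b q :: int
  assumes "0 \<le> a" "a < q" "0 \<le> b" "b < q"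
  shows "q dvd a - b \<longleftrightarrow> a = b"
  using assms cong_less_imp_eq_int[of a q b] by (auto simp: cong_iff_dvd_diff)

definition ehat :: "int \<Rightarrow> int \<Rightarrow> int \<Rightarrow> complex" where
  "ehat q L s = (\<Sum>i\<in>{0..<L}. echar q (i * s))"

lemma ehat_0: "L \<ge> 0 \<Longrightarrow> ehat q L 0 = of_int L"
  by (simp add: ehat_def)

lemma ehat_cong: "q > 0 \<Longrightarrow> [s = s'] (mod q) \<Longrightarrow> ehat q L s = ehat q L s'"
  unfolding ehat_def by (intro sum.cong refl echar_cong cong_mult cong_refl)

lemma ehat_mod: "q > 0 \<Longrightarrow> ehat q L (s mod q) = ehat q L s"
  by (rule ehat_cong) (auto simp: cong_def)

text \<open>The squared modulus is the transform of the number of ways to write a residue as a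
  difference of two elements of the interval, that is, a Fejer kernel.\<close>

lemma ehat_mult_cnj:
  "ehat q L s * cnj (ehat q L s) = (\<Sum>i\<in>{0..<L}. \<Sum>j\<in>{0..<L}. echar q (s * (j - i)))"
proof -
  have "echar q (s * (j - i)) = cnj (echar q (i * s)) * echar q (j * s)" for i j
    by (simp add: algebra_simps flip: echar_add echar_minus)
  then show ?thesis
    unfolding ehat_def cnj_sum by (subst mult.commute) (simp only: sum_product)
qed

text \<open>Parseval's identity; \<open>L \<le> q\<close> makes the elements of the interval
  distinct modulo \<open>q\<close>.\<close>

lemma sum_norm_ehat:
  assumes "0 < q" "0 \<le> L" "L \<le> q"
  shows "(\<Sum>s\<in>{0..<q}. (norm (ehat q L s))\<^sup>2) = of_int (q * L)"
proof -
  have "complex_of_real (\<Sum>s\<in>{0..<q}. (norm (ehat q L s))\<^sup>2) =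
      (\<Sum>s\<in>{0..<q}. \<Sum>i\<in>{0..<L}. \<Sum>j\<in>{0..<L}. echar q (s * (j - i)))"
    by (simp only: of_real_sum complex_norm_square ehat_mult_cnj)
  also have "\<dots> = (\<Sum>i\<in>{0..<L}. \<Sum>j\<in>{0..<L}. \<Sum>s\<in>{0..<q}. echar q (s * (j - i)))"
    by (subst sum.swap, rule sum.cong[OF refl], rule sum.swap)
  also have "\<dots> = (\<Sum>i\<in>{0..<L}. \<Sum>j\<in>{0..<L}. if j = i then of_int q else 0)"
  proof (intro sum.cong refl)
    fix i j assume "i \<in> {0..<L}" "j \<in> {0..<L}"
    then have "q dvd (j - i) \<longleftrightarrow> j = i"
      using assms by (intro dvd_diff_iff_eq) auto
    then show "(\<Sum>s\<in>{0..<q}. echar q (s * (j - i))) = (if j = i then of_int q else 0)"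
      using assms by (simp add: sum_echar)
  qed
  also have "\<dots> = (\<Sum>i\<in>{0..<L}. of_int q)"
    by (intro sum.cong refl) simp
  also have "\<dots> = complex_of_real (of_int (q * L))" using assms by simp
  finally show ?thesis by (simp only: of_real_eq_iff)
qed

text \<open>By \<open>cubic_fiber_le_3\<close> each frequency modulo \<open>q\<close> is hit by at
  most three values of \<open>y\<close>, so the sum is at most three Parseval sums. At the trivial
  frequency it would be \<open>(q - 1) * L ^ 2\<close>, larger by a factor of order
  \<open>L\<close>.\<close>

lemma sum_ehat_moment_le:
  assumes "prime q" "0 \<le> L" "L \<le> q" "\<not> cong3 q x 0"
  shows "(\<Sum>y\<in>{1..<q}. (norm (ehat q L (dot3 x (moment 1 y))))\<^sup>2) \<le> 3 * of_int (q * L)"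
proof -
  have q: "q > 0" using assms(1) prime_gt_0_int by blast
  obtain a b c where x: "x = (a, b, c)" by (cases x)
  define f where "f y = dot3 x (moment 1 y) mod q" for y
  have "(\<Sum>y\<in>{1..<q}. (norm (ehat q L (dot3 x (moment 1 y))))\<^sup>2) = (\<Sum>y\<in>{1..<q}. (norm (ehat q L (f y)))\<^sup>2)"
    unfolding f_def using q by (intro sum.cong refl) (simp add: ehat_mod)
  also have "\<dots> = (\<Sum>s\<in>{0..<q}. \<Sum>y\<in>{y\<in>{1..<q}. f y = s}. (norm (ehat q L (f y)))\<^sup>2)"
    using q by (intro sum.group[symmetric]) (auto simp: f_def)
  also have "\<dots> \<le> (\<Sum>s\<in>{0..<q}. 3 * (norm (ehat q L s))\<^sup>2)"
  proof (rule sum_mono)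
    fix s assume s: "s \<in> {0..<q}"
    have "{y\<in>{1..<q}. f y = s} = {y \<in> {1..<q}. [a * y + b * y ^ 2 + c * y ^ 3 = s] (mod q)}"
      using s by (simp add: f_def x moment_def cong_def)
    then have "card {y\<in>{1..<q}. f y = s} \<le> 3"
      using cubic_fiber_le_3[of q a b c s] assms(1,4) x by simp
    then have "real (card {y\<in>{1..<q}. f y = s}) * (norm (ehat q L s))\<^sup>2 \<le> 3 * (norm (ehat q L s))\<^sup>2"
      by (intro mult_right_mono) auto
    then show "(\<Sum>y\<in>{y\<in>{1..<q}. f y = s}. (norm (ehat q L (f y)))\<^sup>2) \<le> 3 * (norm (ehat q L s))\<^sup>2"
      by simp
  qed
  also have "\<dots> = 3 * of_int (q * L)"
    using sum_norm_ehat[OF q assms(2,3)] by (simp flip: sum_distrib_left)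
  finally show ?thesis .
qed

section \<open>The spectral bound for independent sets of triples\<close>

definition shat :: "int \<Rightarrow> vec3 set \<Rightarrow> vec3 \<Rightarrow> complex" where
  "shat q S x = (\<Sum>u\<in>S. echar q (dot3 x u))"

lemma shat_mult_cnj:
  "shat q S x * cnj (shat q S x) = (\<Sum>u\<in>S. \<Sum>v\<in>S. echar q (dot3 x (v - u)))"
proof -
  have "echar q (dot3 x (v - u)) = cnj (echar q (dot3 x u)) * echar q (dot3 x v)" for u v
    by (simp add: dot3_diff flip: echar_add echar_minus)
  then show ?thesis
    unfolding shat_def cnj_sum by (subst mult.commute) (simp only: sum_product)
qed

lemma cong3_0_box3:
  assumes "u \<in> box3 q" "v \<in> box3 q"
  shows "cong3 q (v - u) 0 \<longleftrightarrow> v = u"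
proof -
  obtain u1 u2 u3 where u: "u = (u1, u2, u3)" by (cases u)
  obtain v1 v2 v3 where v: "v = (v1, v2, v3)" by (cases v)
  show ?thesis
    using assms unfolding u v zero_prod_def
    by (simp add: box3_def dvd_diff_iff_eq cong_0_iff)
qed

lemma sum_norm_shat:
  assumes "q > 0" "S \<subseteq> box3 q"
  shows "(\<Sum>x\<in>box3 q. (norm (shat q S x))\<^sup>2) = of_int q ^ 3 * card S"
proof -
  have fin: "finite S" using assms finite_subset finite_box3 by blast
  have "complex_of_real (\<Sum>x\<in>box3 q. (norm (shat q S x))\<^sup>2) =
      (\<Sum>x\<in>box3 q. \<Sum>u\<in>S. \<Sum>v\<in>S. echar q (dot3 x (v - u)))"
    by (simp only: of_real_sum complex_norm_square shat_mult_cnj)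
  also have "\<dots> = (\<Sum>u\<in>S. \<Sum>v\<in>S. \<Sum>x\<in>box3 q. echar q (dot3 x (v - u)))"
    by (subst sum.swap, rule sum.cong[OF refl], rule sum.swap)
  also have "\<dots> = (\<Sum>u\<in>S. \<Sum>v\<in>S. if v = u then of_int q ^ 3 else 0)"
  proof (intro sum.cong refl)
    fix u v assume "u \<in> S" "v \<in> S"
    then have "cong3 q (v - u) 0 \<longleftrightarrow> v = u" using assms by (intro cong3_0_box3) auto
    then show "(\<Sum>x\<in>box3 q. echar q (dot3 x (v - u))) = (if v = u then of_int q ^ 3 else 0)"
      using sum_echar_dot3[OF assms(1), of "v - u"] by presburger
  qed
  also have "\<dots> = complex_of_real (of_int q ^ 3 * card S)" using fin by simp
  finally show ?thesis by (simp only: of_real_eq_iff)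
qed

text \<open>A Hoffman-type bound. The weighted count of pairs of \<open>S\<close> joined by a moment
  vector is zero, so the term at frequency 0, of size \<open>(card S) ^ 2 * (q - 1) * L ^ 2\<close>,
  is cancelled by the others. Those are bounded by \<open>3 * q * L\<close> times the Parseval sum
  of \<open>S\<close>.\<close>

lemma independent_box3_bound:
  assumes q: "prime q" and L: "0 < L" "L \<le> q" and S: "S \<subseteq> box3 q"
    and indep: "\<And>u v t y. u \<in> S \<Longrightarrow> v \<in> S \<Longrightarrow> 2 * L < t \<Longrightarrow> t < 4 * L \<Longrightarrow> 0 < y \<Longrightarrow> y < q \<Longrightarrow>
                  \<not> cong3 q (v - u - moment t y) 0"
  shows "int (card S) * (q - 1) * L \<le> 3 * q ^ 4"
proof -
  have q0: "q > 0" using q prime_gt_0_int by blast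
  define g where "g x y = dot3 x (moment 1 y)" for x y
  define H where "H x = (\<Sum>y\<in>{1..<q}. echar q (- 3 * L * g x y) * (norm (ehat q L (g x y)))\<^sup>2)" for x
  let ?I = "{0..<L}"
  \<comment> \<open>\<open>H\<close> is the Fourier transform of the vectors \<open>moment (3 * L + i - j) y\<close> with \<open>0 \<le> i, j < L\<close>.\<close>
  have "(\<Sum>x\<in>box3 q. (norm (shat q S x))\<^sup>2 * H x) =
     (\<Sum>x\<in>box3 q. \<Sum>y\<in>{1..<q}. \<Sum>u\<in>S. \<Sum>v\<in>S. \<Sum>i\<in>?I. \<Sum>j\<in>?I.
        echar q (dot3 x (v - u - moment (3 * L + i - j) y)))"
  proof (rule sum.cong[OF refl])
    fix x assume "x \<in> box3 q"
    have "(norm (shat q S x))\<^sup>2 * H x = (\<Sum>y\<in>{1..<q}. echar q (- 3 * L * g x y) * 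
        (ehat q L (g x y) * cnj (ehat q L (g x y)) * (shat q S x * cnj (shat q S x))))"
      by (simp add: H_def sum_distrib_left complex_norm_square mult_ac del: of_real_power)
    also have "\<dots> = (\<Sum>y\<in>{1..<q}. \<Sum>u\<in>S. \<Sum>v\<in>S. \<Sum>i\<in>?I. \<Sum>j\<in>?I.
        echar q (- 3 * L * g x y) * (echar q (g x y * (j - i)) * echar q (dot3 x (v - u))))"
      unfolding ehat_mult_cnj shat_mult_cnj by (simp only: sum_distrib_left sum_distrib_right)
    also have "\<dots> = (\<Sum>y\<in>{1..<q}. \<Sum>u\<in>S. \<Sum>v\<in>S. \<Sum>i\<in>?I. \<Sum>j\<in>?I.
        echar q (dot3 x (v - u - moment (3 * L + i - j) y)))"
      unfolding echar_add[symmetric] dot3_diff[of _ _ "moment _ _"] dot3_moment[of _ "3 * L + _ - _"] g_def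
      by (intro sum.cong refl arg_cong[of _ _ "echar q"]) (simp add: algebra_simps)
    finally show "(norm (shat q S x))\<^sup>2 * H x = \<dots>" .
  qed
  also have "\<dots> = (\<Sum>y\<in>{1..<q}. \<Sum>u\<in>S. \<Sum>v\<in>S. \<Sum>i\<in>?I. \<Sum>j\<in>?I. \<Sum>x\<in>box3 q.
        echar q (dot3 x (v - u - moment (3 * L + i - j) y)))"
    by (subst sum.swap, rule sum.cong[OF refl], subst sum.swap, rule sum.cong[OF refl],
        subst sum.swap, rule sum.cong[OF refl], subst sum.swap, rule sum.cong[OF refl], rule sum.swap)
  \<comment> \<open>The multiplier \<open>3 * L + i - j\<close> lies strictly between
    \<open>2 * L\<close> and \<open>4 * L\<close>, so independence makes every orthogonality sum
    over \<open>x\<close> vanish.\<close>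
  also have "\<dots> = 0"
  proof -
    have "(\<Sum>x\<in>box3 q. echar q (dot3 x (v - u - moment (3 * L + i - j) y))) = 0"
      if "y \<in> {1..<q}" "u \<in> S" "v \<in> S" "i \<in> ?I" "j \<in> ?I" for y u v i j
      using indep[of u v "3 * L + i - j" y] that sum_echar_dot3[OF q0, of "v - u - moment (3 * L + i - j) y"]
      by simp
    then show ?thesis by simp
  qed
  finally have total: "(\<Sum>x\<in>box3 q. (norm (shat q S x))\<^sup>2 * H x) = 0" .
  have zero: "(0::vec3) \<in> box3 q" using q0 by (simp add: box3_def zero_prod_def)
  have dot0: "dot3 0 v = 0" for v by (cases v) (simp add: zero_prod_def)
  have main: "(norm (shat q S 0))\<^sup>2 * H 0 = of_int ((int (card S))\<^sup>2 * ((q - 1) * L\<^sup>2))"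
    using q0 L by (simp add: shat_def H_def dot0 g_def ehat_0)
  have "of_int ((int (card S))\<^sup>2 * ((q - 1) * L\<^sup>2)) = norm ((norm (shat q S 0))\<^sup>2 * H 0)"
    unfolding main norm_of_int using q0 by simp
  also have "\<dots> = norm (\<Sum>x\<in>box3 q - {0}. (norm (shat q S x))\<^sup>2 * H x)"
    using total zero by (simp add: sum.remove add_eq_0_iff)
  also have "\<dots> \<le> (\<Sum>x\<in>box3 q - {0}. (norm (shat q S x))\<^sup>2 * (3 * of_int (q * L)))"
  proof (rule sum_norm_le)
    fix x assume x: "x \<in> box3 q - {0}"
    have "\<not> cong3 q x 0" using cong3_0_box3[OF zero, of x] x by auto
    have "norm (H x) \<le> (\<Sum>y\<in>{1..<q}. (norm (ehat q L (g x y)))\<^sup>2)"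
      unfolding H_def by (intro sum_norm_le) (simp add: norm_mult norm_power)
    also have "\<dots> \<le> 3 * of_int (q * L)"
      unfolding g_def using L by (intro sum_ehat_moment_le[OF q]) (use \<open>\<not> cong3 q x 0\<close> in auto)
    finally show "norm ((norm (shat q S x))\<^sup>2 * H x) \<le> (norm (shat q S x))\<^sup>2 * (3 * of_int (q * L))"
      by (simp add: norm_mult norm_power mult_left_mono)
  qed
  also have "\<dots> \<le> (\<Sum>x\<in>box3 q. (norm (shat q S x))\<^sup>2 * (3 * of_int (q * L)))"
    using L q0 by (intro sum_mono2) auto
  also have "\<dots> = of_int (q ^ 3 * card S * (3 * (q * L)))"
    using sum_norm_shat[OF q0 S] by (simp flip: sum_distrib_right)
  finally have "(int (card S))\<^sup>2 * ((q - 1) * L\<^sup>2) \<le> q ^ 3 * card S * (3 * (q * L))"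
    by (simp only: of_int_le_iff)
  then have "(int (card S) * L) * (int (card S) * (q - 1) * L) \<le> (int (card S) * L) * (3 * q ^ 4)"
    by (simp add: power2_eq_square power4_eq_xxxx power3_eq_cube mult_ac)
  then show ?thesis using L q0
    by (cases "card S = 0") (auto simp: mult_le_cancel_left)
qed

section \<open>The moment curve and its lift\<close>

lemma cong3_diff: "cong3 q (a - b) 0 \<longleftrightarrow> cong3 q a b"
  by (cases a; cases b) (simp add: zero_prod_def cong_iff_dvd_diff)

lemma moment_sum_free:
  assumes q: "prime q" and L: "0 < L" "6 * L \<le> q"
    and t: "2 * L < t1" "t1 < 4 * L" "2 * L < t2" "t2 < 4 * L" "2 * L < t3" "t3 < 4 * L"
    and y: "0 < y1" "y1 < q" "0 < y2" "y2 < q" "0 < y3" "y3 < q"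
  shows "\<not> cong3 q (moment t1 y1 + moment t2 y2) (moment t3 y3)"
proof
  assume "cong3 q (moment t1 y1 + moment t2 y2) (moment t3 y3)"
  then have e: "q dvd t1 * y1 + t2 * y2 - t3 * y3" "q dvd t1 * y1 ^ 2 + t2 * y2 ^ 2 - t3 * y3 ^ 2"
      "q dvd t1 * y1 ^ 3 + t2 * y2 ^ 3 - t3 * y3 ^ 3"
    by (simp_all add: moment_def cong_iff_dvd_diff)
  \<comment> \<open>The relation may be tested against any cubic without constant term; vanishing at two of the
    three points isolates the third.\<close>
  have test: "q dvd a * (t1 * y1 + t2 * y2 - t3 * y3) + b * (t1 * y1 ^ 2 + t2 * y2 ^ 2 - t3 * y3 ^ 2)
      + c * (t1 * y1 ^ 3 + t2 * y2 ^ 3 - t3 * y3 ^ 3)" for a b c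
    using e by (intro dvd_add dvd_mult)
  have ndvd: "\<not> q dvd s" if "0 < s" "s < q" for s using that zdvd_not_zless by blast
  have nt: "\<not> q dvd t1" "\<not> q dvd t2" "\<not> q dvd t3" and ny: "\<not> q dvd y1" "\<not> q dvd y2" "\<not> q dvd y3"
    using t y L ndvd[of t1] ndvd[of t2] ndvd[of t3] ndvd[of y1] ndvd[of y2] ndvd[of y3] by auto
  \<comment> \<open>The test cubic is \<open>Y * (Y - y1) * (Y - y2)\<close>.\<close>
  have "q dvd - (t3 * (y3 * ((y3 - y1) * (y3 - y2))))"
    using test[of "y1 * y2" "- (y1 + y2)" 1] by (simp add: algebra_simps power2_eq_square power3_eq_cube)
  then have "q dvd y3 - y1 \<or> q dvd y3 - y2"
    using nt ny q by (simp add: prime_dvd_mult_iff)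
  then have "y3 = y1 \<or> y3 = y2"
    using y by (simp add: dvd_diff_iff_eq)
  then have "y2 = y1 \<and> y3 = y1"
  proof
    assume y3: "y3 = y1"
    have "q dvd t2 * (y2 * (y2 - y1))"
      using test[of "- y1" 1 0] by (simp add: y3 algebra_simps power2_eq_square)
    then have "q dvd y2 - y1" using nt ny q by (simp add: prime_dvd_mult_iff)
    then show ?thesis using y y3 by (simp add: dvd_diff_iff_eq)
  next
    assume y3: "y3 = y2"
    have "q dvd t1 * (y1 * (y1 - y2))"
      using test[of "- y2" 1 0] by (simp add: y3 algebra_simps power2_eq_square)
    then have "q dvd y1 - y2" using nt ny q by (simp add: prime_dvd_mult_iff)
    then show ?thesis using y y3 by (simp add: dvd_diff_iff_eq)
  qed
  then have "q dvd y1 * (t1 + t2 - t3)" using e(1) by (simp add: algebra_simps)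
  then have "q dvd t1 + t2 - t3" using ny q by (simp add: prime_dvd_mult_iff)
  \<comment> \<open>The bounds on the \<open>t\<close>s put \<open>t1 + t2 - t3\<close> strictly
    between 0 and \<open>6 * L\<close>.\<close>
  then show False using ndvd[of "t1 + t2 - t3"] t L by linarith
qed

text \<open>
  The distances are multiplied by \<open>4 q p\<close> to stay in the integers. Adding a multiple of \<open>p\<close> to \<open>x\<close> changes
  the \<open>b\<^sub>i\<close> by multiples of \<open>q\<close>, so this is a property of \<open>x\<close> modulo \<open>p\<close>.
\<close>

definition near_moment :: "int \<Rightarrow> int \<Rightarrow> int \<Rightarrow> int \<Rightarrow> bool" where
  "near_moment p q L x \<longleftrightarrow> (\<exists>b1 b2 b3 t y.
     2 * L < t \<and> t < 4 * L \<and> 0 < y \<and> y < q \<and> cong3 q (b1, b2, b3) (moment t y) \<and>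
     \<bar>(4 * q) * x - 4 * b1 * p\<bar> < p \<and> \<bar>(4 * q) ^ 2 * x - 4 * b2 * p\<bar> < p \<and> \<bar>(4 * q) ^ 3 * x - 4 * b3 * p\<bar> < p)"

text \<open>Combining the three errors gives a multiple of \<open>4 * p\<close> of absolute value
  below \<open>3 * p\<close>, hence zero.\<close>

lemma near_add_eq:
  fixes p :: int
  assumes "\<bar>4 * m * x - 4 * b * p\<bar> < p" "\<bar>4 * m * y - 4 * c * p\<bar> < p" "\<bar>4 * m * z - 4 * d * p\<bar> < p"
    and "x + y - z = k * p"
  shows "b + c - d = m * k"
proof -
  have "4 * m * x - 4 * b * p + (4 * m * y - 4 * c * p) - (4 * m * z - 4 * d * p) = 4 * m * (x + y - z) - 4 * (b + c - d) * p"
    by (simp add: algebra_simps)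
  also have "\<dots> = 4 * (m * k - (b + c - d)) * p"
    unfolding assms(4) by (simp add: algebra_simps)
  finally have "\<bar>4 * (m * k - (b + c - d)) * p\<bar> < 3 * p"
    using assms(1-3) by linarith
  then have "\<bar>4 * (m * k - (b + c - d))\<bar> * p < 3 * p"
    using assms(1) by (simp add: abs_mult)
  then have "\<bar>4 * (m * k - (b + c - d))\<bar> < 3"
    using assms(1) by (simp add: mult_less_cancel_right)
  then show ?thesis by presburger
qed

text \<open>A Schur relation modulo \<open>p\<close> passes, by \<open>near_add_eq\<close> in each
  coordinate, to the vectors \<open>b\<close>, \<open>c\<close>, \<open>d\<close> modulo
  \<open>q\<close>, and thus to the moment vectors, where \<open>moment_sum_free\<close> excludes
  it.\<close>

lemma near_moment_sum_free:
  assumes "prime q" "0 < L" "6 * L \<le> q"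
    and "near_moment p q L x" "near_moment p q L y" "near_moment p q L z"
  shows "\<not> p dvd x + y - z"
proof
  assume "p dvd x + y - z"
  then obtain k where k: "x + y - z = k * p" by (auto simp: dvd_def mult.commute)
  obtain b1 b2 b3 t u where b: "2 * L < t" "t < 4 * L" "0 < u" "u < q" "cong3 q (b1, b2, b3) (moment t u)"
     "\<bar>(4 * q) * x - 4 * b1 * p\<bar> < p" "\<bar>(4 * q) ^ 2 * x - 4 * b2 * p\<bar> < p" "\<bar>(4 * q) ^ 3 * x - 4 * b3 * p\<bar> < p"
    using assms(4) unfolding near_moment_def by blast
  obtain c1 c2 c3 t' u' where c: "2 * L < t'" "t' < 4 * L" "0 < u'" "u' < q" "cong3 q (c1, c2, c3) (moment t' u')"
     "\<bar>(4 * q) * y - 4 * c1 * p\<bar> < p" "\<bar>(4 * q) ^ 2 * y - 4 * c2 * p\<bar> < p" "\<bar>(4 * q) ^ 3 * y - 4 * c3 * p\<bar> < p"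
    using assms(5) unfolding near_moment_def by blast
  obtain d1 d2 d3 t'' u'' where d: "2 * L < t''" "t'' < 4 * L" "0 < u''" "u'' < q" "cong3 q (d1, d2, d3) (moment t'' u'')"
     "\<bar>(4 * q) * z - 4 * d1 * p\<bar> < p" "\<bar>(4 * q) ^ 2 * z - 4 * d2 * p\<bar> < p" "\<bar>(4 * q) ^ 3 * z - 4 * d3 * p\<bar> < p"
    using assms(6) unfolding near_moment_def by blast
  \<comment> \<open>After one factor 4 is split off for \<open>near_add_eq\<close>, the cofactors
    are still multiples of \<open>q\<close>.\<close>
  have M: "(4 * q) ^ 2 = 4 * (4 * q ^ 2)" "(4 * q) ^ 3 = 4 * (16 * q ^ 3)" by (simp_all add: power_mult_distrib)
  have "b1 + c1 - d1 = q * k"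
    by (rule near_add_eq[of q x b1 p y c1 z d1 k]) (use b c d k in auto)
  then have s1: "q dvd b1 + c1 - d1" by simp
  have "b2 + c2 - d2 = (4 * q ^ 2) * k"
    by (rule near_add_eq[of "4 * q ^ 2" x b2 p y c2 z d2 k]) (use b(7) c(7) d(7) k in \<open>simp_all only: M\<close>)
  then have s2: "q dvd b2 + c2 - d2" by (simp add: power2_eq_square)
  have "b3 + c3 - d3 = (16 * q ^ 3) * k"
    by (rule near_add_eq[of "16 * q ^ 3" x b3 p y c3 z d3 k]) (use b(8) c(8) d(8) k in \<open>simp_all only: M\<close>)
  then have s3: "q dvd b3 + c3 - d3" by (simp add: power3_eq_cube)
  have "[t * u + t' * u' = b1 + c1] (mod q)" "[t * u ^ 2 + t' * u' ^ 2 = b2 + c2] (mod q)"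
      "[t * u ^ 3 + t' * u' ^ 3 = b3 + c3] (mod q)"
    using b(5) c(5) by (auto simp: moment_def intro!: cong_add dest: cong_sym)
  moreover have "[b1 + c1 = d1] (mod q)" "[b2 + c2 = d2] (mod q)" "[b3 + c3 = d3] (mod q)"
    using s1 s2 s3 by (simp_all add: cong_iff_dvd_diff)
  moreover have "[d1 = t'' * u''] (mod q)" "[d2 = t'' * u'' ^ 2] (mod q)" "[d3 = t'' * u'' ^ 3] (mod q)"
    using d(5) by (auto simp: moment_def)
  ultimately have "cong3 q (moment t u + moment t' u') (moment t'' u'')"
    by (simp add: moment_def) (metis cong_trans)
  then show False using moment_sum_free[OF assms(1-3)] b c d by blast
qed

lemma near_moment_shift:
  assumes "near_moment p q L x"
  shows "near_moment p q L (x + k * p)"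
proof -
  obtain b1 b2 b3 t u where b: "2 * L < t" "t < 4 * L" "0 < u" "u < q" "cong3 q (b1, b2, b3) (moment t u)"
     "\<bar>(4 * q) * x - 4 * b1 * p\<bar> < p" "\<bar>(4 * q) ^ 2 * x - 4 * b2 * p\<bar> < p" "\<bar>(4 * q) ^ 3 * x - 4 * b3 * p\<bar> < p"
    using assms unfolding near_moment_def by blast
  have *: "[b + q * j = c] (mod q) \<longleftrightarrow> [b = c] (mod q)" for b c j by (simp add: cong_def)
  have c: "cong3 q (b1 + q * k, b2 + q * (4 * q * k), b3 + q * (16 * q ^ 2 * k)) (moment t u)"
    using b(5) unfolding moment_def cong3.simps * .
  show ?thesis unfolding near_moment_def
    by (rule exI[of _ "b1 + q * k"], rule exI[of _ "b2 + q * (4 * q * k)"], rule exI[of _ "b3 + q * (16 * q ^ 2 * k)"],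
        rule exI[of _ t], rule exI[of _ u])
      (use b c in \<open>simp add: algebra_simps power2_eq_square power3_eq_cube\<close>)
qed

lemma near_moment_mod: "near_moment p q L (x mod p) \<longleftrightarrow> near_moment p q L x"
proof -
  have "x mod p + (x div p) * p = x" "x + (- (x div p)) * p = x mod p"
    by (simp_all add: minus_div_mult_eq_mod)
  then show ?thesis using near_moment_shift[of p q L] by metis
qed

section \<open>Counting through base-\<open>M\<close> digits\<close>

lemma card_le_card_mult_fiber:
  assumes "finite B" "f ` A \<subseteq> B" "finite A" "\<And>b. b \<in> B \<Longrightarrow> card {a \<in> A. f a = b} \<le> n"
  shows "card A \<le> card B * n"
proof -
  have "card A = (\<Sum>a\<in>A. 1)" by simp
  also have "\<dots> = (\<Sum>b\<in>B. \<Sum>a\<in>{a \<in> A. f a = b}. 1)"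
    using assms by (intro sum.group[symmetric])
  also have "\<dots> \<le> (\<Sum>b\<in>B. n)" using assms(4) by (intro sum_mono) simp
  finally show ?thesis by simp
qed

text \<open>Two elements of the fiber differ by at most \<open>p div N\<close>, since
  \<open>N\<close> times their difference is less than \<open>p\<close>.\<close>

lemma card_div_fiber_le:
  fixes p N k :: int
  assumes "p > 0" "N > 0" "finite S"
  shows "int (card {x \<in> S. N * x div p = k}) \<le> p div N + 1"
proof (cases "{x \<in> S. N * x div p = k} = {}")
  case True
  then show ?thesis using assms by (simp add: pos_imp_zdiv_nonneg_iff add_nonneg_pos less_imp_le del: Collect_empty_eq)
next
  case False
  define F where "F = {x \<in> S. N * x div p = k}"
  define m where "m = Min F"
  have fin: "finite F" "F \<noteq> {}" using assms False by (auto simp: F_def)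
  have "F \<subseteq> {m..m + p div N}"
  proof
    fix x assume x: "x \<in> F"
    have m: "m \<in> F" "m \<le> x" using fin x by (auto simp: m_def)
    have "N * x = k * p + N * x mod p" "N * m = k * p + N * m mod p"
      using x m(1) div_mult_mod_eq[of "N * x" p] div_mult_mod_eq[of "N * m" p] by (simp_all add: F_def)
    moreover have "N * x mod p < p" "0 \<le> N * m mod p" using assms by auto
    ultimately have "N * (x - m) \<le> p" by (simp only: right_diff_distrib)
    then have "N * (x - m) div N \<le> p div N" using assms by (intro zdiv_mono1)
    then have "x - m \<le> p div N" using assms by simp
    then show "x \<in> {m..m + p div N}" using m by auto
  qed
  then have "card F \<le> card {m..m + p div N}" by (intro card_mono) auto
  also have "int \<dots> = p div N + 1" using assms by (simp add: pos_imp_zdiv_nonneg_iff)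
  finally show ?thesis unfolding F_def by simp
qed

text \<open>For \<open>0 \<le> x < p\<close> these are the prefixes formed by the first one, two and
  three base-\<open>M\<close> digits of \<open>x / p\<close>; the digits themselves are their
  residues modulo \<open>M\<close>.\<close>

definition digits3 :: "int \<Rightarrow> int \<Rightarrow> int \<Rightarrow> vec3" where
  "digits3 p M x = (M * x div p, M ^ 2 * x div p, M ^ 3 * x div p)"

lemma div_mult_div_eq:
  fixes p M a :: int
  assumes "p > 0" "M > 0"
  shows "(M * a div p) div M = a div p"
proof -
  have "(M * a div p) div M = (M * a) div (p * M)" using assms by (simp add: zdiv_zmult2_eq)
  also have "\<dots> = a div p" using assms by (simp add: mult.commute[of p])
  finally show ?thesis .
qed

text \<open>All prefixes start from \<open>x div p = 0\<close>. By \<open>div_mult_div_eq\<close>,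
  removing the last digit of a prefix gives the previous one, so equal digits successively give
  equal prefixes.\<close>

lemma digits3_determined:
  fixes p M x x' :: int
  assumes "p > 0" "M > 0" "0 \<le> x" "x < p" "0 \<le> x'" "x' < p"
    and "M * x div p mod M = M * x' div p mod M"
    and "M ^ 2 * x div p mod M = M ^ 2 * x' div p mod M"
    and "M ^ 3 * x div p mod M = M ^ 3 * x' div p mod M"
  shows "M ^ 3 * x div p = M ^ 3 * x' div p"
proof -
  have eq: "M * a div p = M * a' div p"
    if "a div p = a' div p" "M * a div p mod M = M * a' div p mod M" for a a'
    using that div_mult_div_eq[OF assms(1,2)] by (metis div_mult_mod_eq)
  have "M * x div p = M * x' div p"
    by (rule eq) (use assms in auto)
  then have "M * (M * x) div p = M * (M * x') div p"
    by (rule eq) (use assms(8) in \<open>auto simp: power2_eq_square mult.assoc\<close>)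
  then have "M * (M * (M * x)) div p = M * (M * (M * x')) div p"
    by (rule eq) (use assms(9) in \<open>auto simp: power3_eq_cube mult.assoc\<close>)
  then show ?thesis by (simp add: power3_eq_cube mult.assoc)
qed

definition red3 :: "int \<Rightarrow> vec3 \<Rightarrow> vec3" where
  "red3 q v = (case v of (a, b, c) \<Rightarrow> (a mod q, b mod q, c mod q))"

definition quot3 :: "int \<Rightarrow> vec3 \<Rightarrow> vec3" where
  "quot3 q v = (case v of (a, b, c) \<Rightarrow> (a div q, b div q, c div q))"

lemma red3_in_box3: "q > 0 \<Longrightarrow> red3 q v \<in> box3 q"
  by (cases v) (auto simp: red3_def box3_def)

text \<open>\<open>S\<close> is split into 64 classes by its digits modulo 4. Within a class, the
  quarters of the digits modulo \<open>q\<close> form an independent set of triples, of size at most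
  \<open>a\<close>, and the points over one triple share all three digits, so they lie in an
  interval of length about \<open>p / (4 * q) ^ 3\<close>.\<close>

lemma independent_near_moment_bound:
  fixes p q L :: int
  assumes p: "p > 0" and q: "prime q" and L: "0 < L" "6 * L \<le> q"
    and S: "S \<subseteq> {0..<p}" "\<And>u v. u \<in> S \<Longrightarrow> v \<in> S \<Longrightarrow> u \<noteq> v \<Longrightarrow> \<not> near_moment p q L (v - u)"
    and a: "\<And>T. T \<subseteq> box3 q \<Longrightarrow> (\<And>u v t y. u \<in> T \<Longrightarrow> v \<in> T \<Longrightarrow> 2 * L < t \<Longrightarrow> t < 4 * L \<Longrightarrow> 0 < y \<Longrightarrow> y < q \<Longrightarrow>
                  \<not> cong3 q (v - u - moment t y) 0) \<Longrightarrow> card T \<le> a"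
  shows "card S \<le> 64 * (a * nat (p div (4 * q) ^ 3 + 1))"
proof -
  have q0: "q > 0" using q prime_gt_0_int by blast
  have fin: "finite S" using finite_subset[OF S(1)] by simp
  define M where "M = 4 * q"
  have M: "M > 0" using q0 by (simp add: M_def)
  \<comment> \<open>Within a class of digits modulo 4, differences of digits are multiples of 4 and their quarters
    are the \<open>b\<^sub>i\<close> of the definition of \<open>near_moment\<close>.\<close>
  define r where "r x = red3 4 (digits3 p M x)" for x
  define g where "g x = red3 q (quot3 4 (digits3 p M x))" for x
  have "card S \<le> card (box3 4) * (a * nat (p div (4 * q) ^ 3 + 1))"
  proof (rule card_le_card_mult_fiber[where f = r])
    show "r ` S \<subseteq> box3 4" by (simp add: image_subset_iff r_def red3_in_box3)
    fix c :: vec3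
    define C where "C = {u \<in> S. r u = c}"
    have finC: "finite C" using fin by (simp add: C_def)
    have "card C \<le> card (g ` C) * nat (p div M ^ 3 + 1)"
    proof (rule card_le_card_mult_fiber[where f = g])
      fix b assume "b \<in> g ` C"
      then obtain x0 where x0: "x0 \<in> C" "b = g x0" by auto
      have "{x \<in> C. g x = b} \<subseteq> {x \<in> C. M ^ 3 * x div p = M ^ 3 * x0 div p}"
      proof safe
        fix x assume x: "x \<in> C" "b = g x"
        \<comment> \<open>As \<open>M = 4 * q\<close>, the classes under \<open>r\<close> and
          \<open>g\<close> together recover each digit.\<close>
        have eq: "a mod M = b mod M" if "a mod 4 = b mod 4" "a div 4 mod q = b div 4 mod q" for a b
          using that by (simp only: M_def zmod_zmult2_eq[OF less_imp_le[OF q0]])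
        have "r x = r x0" "g x = g x0" using x x0 by (auto simp: C_def)
        then have e: "M * x div p mod M = M * x0 div p mod M" "M ^ 2 * x div p mod M = M ^ 2 * x0 div p mod M"
            "M ^ 3 * x div p mod M = M ^ 3 * x0 div p mod M"
          by (auto simp: r_def g_def red3_def quot3_def digits3_def intro!: eq)
        have "x \<in> {0..<p}" "x0 \<in> {0..<p}" using x(1) x0(1) S(1) unfolding C_def by blast+
        then show "M ^ 3 * x div p = M ^ 3 * x0 div p"
          by (intro digits3_determined[OF p M] e) simp_all
      qed
      then have "card {x \<in> C. g x = b} \<le> card {x \<in> C. M ^ 3 * x div p = M ^ 3 * x0 div p}"
        using finC by (intro card_mono) auto
      also have "int \<dots> \<le> p div M ^ 3 + 1"
        by (rule card_div_fiber_le) (use p M finC in auto)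
      finally show "card {x \<in> C. g x = b} \<le> nat (p div M ^ 3 + 1)" by linarith
    qed (use finC in auto)
    also have "card (g ` C) \<le> a"
    proof (rule a)
      show "g ` C \<subseteq> box3 q" using q0 by (simp add: image_subset_iff g_def red3_in_box3)
      fix gu gv t y assume uv: "gu \<in> g ` C" "gv \<in> g ` C" and t: "2 * L < t" "t < 4 * L" and y: "0 < y" "y < q"
      show "\<not> cong3 q (gv - gu - moment t y) 0"
      proof
        assume cong: "cong3 q (gv - gu - moment t y) 0"
        obtain u v where u: "u \<in> C" "gu = g u" and v: "v \<in> C" "gv = g v" using uv by auto
        \<comment> \<open>Independence of \<open>S\<close> concerns distinct points only. For equal
          points, \<open>q\<close> would divide \<open>t * y\<close>, although \<open>t\<close> and
          \<open>y\<close> lie strictly between 0 and \<open>q\<close>.\<close>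
        have "u \<noteq> v"
        proof
          assume "u = v"
          then have "q dvd t * y" using cong u v by (simp add: moment_def zero_prod_def cong_0_iff)
          then show False using q t y L zdvd_not_zless[of y q] zdvd_not_zless[of t q]
            by (auto simp: prime_dvd_mult_iff)
        qed
        define f where "f i x = M ^ i * x div p" for i :: nat and x
        define b where "b i = f i v div 4 - f i u div 4" for i
        have "r v = r u" using u(1) v(1) by (simp add: C_def)
        then have rr: "f i v mod 4 = f i u mod 4" if "i \<in> {1, 2, 3}" for i
          using that by (auto simp: r_def red3_def digits3_def f_def)
        have near: "\<bar>M ^ i * (v - u) - 4 * b i * p\<bar> < p" if "i \<in> {1, 2, 3}" for i
        proof -
          have "4 * b i = f i v - f i u"
            using rr[OF that] unfolding b_def by presburger
          then have e: "4 * b i * p = (f i v - f i u) * p" by simp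
          have "M ^ i * (v - u) - 4 * b i * p = (M ^ i * v - f i v * p) - (M ^ i * u - f i u * p)"
            unfolding e by (simp add: algebra_simps)
          also have "\<dots> = M ^ i * v mod p - M ^ i * u mod p"
            by (simp add: f_def minus_div_mult_eq_mod)
          finally have eq: "M ^ i * (v - u) - 4 * b i * p = M ^ i * v mod p - M ^ i * u mod p" .
          have "0 \<le> M ^ i * v mod p" "M ^ i * v mod p < p" "0 \<le> M ^ i * u mod p" "M ^ i * u mod p < p"
            using p by auto
          then show ?thesis unfolding eq by linarith
        qed
        have "cong3 q (b 1, b 2, b 3) (moment t y)"
          using cong unfolding cong3_diff u(2) v(2) 
          by (simp add: g_def red3_def quot3_def digits3_def moment_def b_def f_def cong_def mod_diff_eq)
        then have "near_moment p q L (v - u)"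
          unfolding near_moment_def
          by (rule_tac x = "b 1" in exI, rule_tac x = "b 2" in exI, rule_tac x = "b 3" in exI,
              rule_tac x = t in exI, rule_tac x = y in exI)
            (use t y near[of 1] near[of 2] near[of 3] in \<open>simp add: M_def\<close>)
        moreover have "u \<in> S" "v \<in> S" using u(1) v(1) by (simp_all add: C_def)
        ultimately show False using S(2) \<open>u \<noteq> v\<close> by blast
      qed
    qed
    finally show "card {u \<in> S. r u = c} \<le> a * nat (p div (4 * q) ^ 3 + 1)"
      by (simp add: C_def M_def mult_right_mono)
  qed (use fin in auto)
  then show ?thesis by (simp add: card_box3)
qed

text \<open>The second coordinate relation minus \<open>y'\<close> times the first leaves
  \<open>t * y * (y - y')\<close>, which forces \<open>y = y'\<close>; then the first gives
  \<open>t = t'\<close>.\<close>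

lemma moment_inject:
  assumes q: "prime q" and t: "0 < t" "t < q" "0 < t'" "t' < q" and y: "0 < y" "y < q" "0 < y'" "y' < q"
    and c: "cong3 q (moment t y) (moment t' y')"
  shows "t = t' \<and> y = y'"
proof -
  have d: "q dvd t * y - t' * y'" "q dvd t * y ^ 2 - t' * y' ^ 2"
    using c by (simp_all add: moment_def cong_iff_dvd_diff)
  have ndvd: "\<not> q dvd s" if "0 < s" "s < q" for s using that zdvd_not_zless by blast
  have "q dvd (t * y ^ 2 - t' * y' ^ 2) - y' * (t * y - t' * y')"
    by (rule dvd_diff[OF d(2) dvd_mult[OF d(1)]])
  also have "\<dots> = t * (y * (y - y'))" by (simp add: algebra_simps power2_eq_square)
  finally have "q dvd y - y'" using q ndvd t y by (simp add: prime_dvd_mult_iff)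
  then have yy: "y = y'" using y by (simp add: dvd_diff_iff_eq)
  then have "q dvd (t - t') * y" using d(1) by (simp add: algebra_simps)
  then have "q dvd t - t'" using q ndvd y by (simp add: prime_dvd_mult_iff)
  then show ?thesis using yy t by (simp add: dvd_diff_iff_eq)
qed

text \<open>Each of the \<open>(2 * L - 1) * (q - 1)\<close> pairs \<open>(t, y)\<close> selects a
  digit cell containing at least \<open>p div (4 * q) ^ 3\<close> integers, and the cells are
  distinct by \<open>moment_inject\<close>.\<close>

lemma near_moment_card_ge:
  fixes p q L :: int
  assumes p: "p > 0" and q: "prime q" and L: "0 < L" "6 * L \<le> q"
  shows "(2 * L - 1) * (q - 1) * (p div (4 * q) ^ 3) \<le> int (card {x \<in> {0..<p}. near_moment p q L x})"
proof -
  have q0: "q > 0" using q prime_gt_0_int by blast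
  define M where "M = 4 * q"
  have M: "M > 0" "M \<ge> 4" using q0 by (auto simp: M_def)
  define N where "N = M ^ 3"
  have N: "N > 0" "N = M * (M * M)" using M by (auto simp: N_def power3_eq_cube)
  define R where "R = {0..<p div N}"
  \<comment> \<open>The number with base-\<open>M\<close> digits \<open>4 * (t * y mod q)\<close>,
    \<open>4 * (t * y ^ 2 mod q)\<close>, \<open>4 * (t * y ^ 3 mod q)\<close>. A quarter of each of
    its prefixes serves as a witness \<open>b1\<close>, \<open>b2\<close> or
    \<open>b3\<close>.\<close>
  define k where "k t y = 4 * ((t * y mod q) * (M * M) + (t * y ^ 2 mod q) * M + t * y ^ 3 mod q)" for t y
  \<comment> \<open>\<open>F (t, y, r)\<close> is the \<open>r\<close>-th integer from \<open>k t y * p / N\<close> upwards.\<close>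
  define F where "F = (\<lambda>(t, y, r). - ((- (k t y * p)) div N) + r)"
  define D where "D = {2 * L<..<4 * L} \<times> {1..<q} \<times> R"
  have digit: "4 * (s mod q) \<le> M - 4" "0 \<le> s mod q" for s
    using q0 pos_mod_bound[of q s] unfolding M_def by (auto simp del: pos_mod_bound)
  have Fk: "N * F (t, y, r) div p = k t y" if "r \<in> R" for t y r
  proof -
    define w where "w = - ((- (k t y * p)) div N)"
    have w: "k t y * p \<le> N * w" "N * w < k t y * p + N"
    proof -
      define d where "d = (- (k t y * p)) div N"
      have "N * d + (- (k t y * p)) mod N = - (k t y * p)" unfolding d_def by (rule mult_div_mod_eq)
      moreover have "0 \<le> (- (k t y * p)) mod N" "(- (k t y * p)) mod N < N" using N(1) by auto
      moreover have "N * w = - (N * d)" by (simp add: w_def d_def)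
      ultimately show "k t y * p \<le> N * w" "N * w < k t y * p + N" by linarith+
    qed
    \<comment> \<open>The strict bound on \<open>r\<close> leaves room for the rounding up in
      \<open>w\<close>, so \<open>w + r\<close> does not leave the cell.\<close>
    have "N * (r + 1) \<le> N * (p div N)" using that N(1) by (intro mult_left_mono) (auto simp: R_def)
    also have "\<dots> \<le> p" using N(1) by (metis mult.commute div_mult_mod_eq le_add_same_cancel1 pos_mod_sign)
    finally have "N * r + N \<le> p" by (simp add: algebra_simps)
    moreover have "0 \<le> N * r" using that N(1) by (simp add: R_def)
    ultimately have "k t y * p \<le> N * (w + r)" "N * (w + r) < (k t y + 1) * p"
      using w by (auto simp: algebra_simps)
    then have "N * (w + r) div p = k t y"
      using p by (intro int_div_pos_eq[of _ _ _ "N * (w + r) - k t y * p"]) (auto simp: algebra_simps)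
    then show ?thesis by (simp add: F_def w_def)
  qed
  have kdigits: "k t y div M = 4 * ((t * y mod q) * M + t * y ^ 2 mod q)"
     "k t y div M div M = 4 * (t * y mod q)" "k t y div M div M div M = 0" for t y
  proof -
    have a: "(M * u + 4 * (s mod q)) div M = u" for u s
      using M digit[of s] by simp
    have k: "k t y = M * (4 * ((t * y mod q) * M + t * y ^ 2 mod q)) + 4 * (t * y ^ 3 mod q)"
      by (simp add: k_def algebra_simps)
    show k1: "k t y div M = 4 * ((t * y mod q) * M + t * y ^ 2 mod q)" unfolding k a ..
    have "4 * ((t * y mod q) * M + t * y ^ 2 mod q) = M * (4 * (t * y mod q)) + 4 * (t * y ^ 2 mod q)"
      by (simp add: algebra_simps)
    then show k2: "k t y div M div M = 4 * (t * y mod q)" unfolding k1 using a by metis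
    show "k t y div M div M div M = 0" unfolding k2 using a[of 0 "t * y"] by simp
  qed
  have digits: "M * (M * x) div p = k t y div M" "M * x div p = k t y div M div M" "x div p = 0"
    if "N * x div p = k t y" for x t y
  proof -
    have dd: "(M * a div p) div M = a div p" for a using div_mult_div_eq p M by simp
    have kk: "k t y = M * (M * (M * x)) div p" using that N(2) by (simp add: mult.assoc)
    show "M * (M * x) div p = k t y div M" unfolding kk dd ..
    show "M * x div p = k t y div M div M" unfolding kk dd ..
    show "x div p = 0" using kdigits(3)[of t y] unfolding kk dd .
  qed
  have "inj_on F D"
  proof (rule inj_onI, clarsimp simp: D_def)
    fix t y r t' y' r' assume *: "F (t, y, r) = F (t', y', r')" "2 * L < t" "t < 4 * L" "2 * L < t'" "t' < 4 * L"
      "1 \<le> y" "y < q" "1 \<le> y'" "y' < q" "r \<in> R" "r' \<in> R"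
    then have kk: "k t y = k t' y'" using Fk by metis
    have e1: "t * y mod q = t' * y' mod q" using kk kdigits(2)[of t y] kdigits(2)[of t' y'] by simp
    have e2: "t * y ^ 2 mod q = t' * y' ^ 2 mod q" using kk e1 kdigits(1)[of t y] kdigits(1)[of t' y'] by simp
    have e3: "t * y ^ 3 mod q = t' * y' ^ 3 mod q" using kk e1 e2 by (simp add: k_def)
    have "t = t' \<and> y = y'"
      using * e1 e2 e3 L by (intro moment_inject[OF q]) (auto simp: moment_def cong_def)
    then show "t = t' \<and> y = y' \<and> r = r'" using *(1) by (simp add: F_def)
  qed
  moreover have "F ` D \<subseteq> {x \<in> {0..<p}. near_moment p q L x}"
  proof (clarsimp simp: D_def)
    fix t y r assume *: "2 * L < t" "t < 4 * L" "1 \<le> y" "y < q" "r \<in> R"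
    define x where "x = F (t, y, r)"
    note dx = digits[OF Fk[OF *(5), of t y], folded x_def]
    have "x mod p = x" using dx(3) div_mult_mod_eq[of x p] by simp
    then have x: "0 \<le> x" "x < p" using pos_mod_sign[OF p, of x] pos_mod_bound[OF p, of x] by linarith+
    have near: "\<bar>a - 4 * b * p\<bar> < p" if "a div p = 4 * b" for a b
    proof -
      have "a - 4 * b * p = a mod p" using that minus_div_mult_eq_mod[of a p] by simp
      then show ?thesis using p by simp
    qed
    have "near_moment p q L x" unfolding near_moment_def
    proof (intro exI conjI)
      show "2 * L < t" "t < 4 * L" "y < q" "0 < y" using * by auto
      let ?b1 = "t * y mod q" and ?b2 = "(t * y mod q) * M + t * y ^ 2 mod q"
      let ?b3 = "(t * y mod q) * (M * M) + (t * y ^ 2 mod q) * M + t * y ^ 3 mod q"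
      show "\<bar>4 * q * x - 4 * ?b1 * p\<bar> < p"
        using dx(2) unfolding kdigits(2) unfolding M_def by (intro near)
      show "\<bar>(4 * q) ^ 2 * x - 4 * ?b2 * p\<bar> < p"
        using dx(1) unfolding kdigits by (intro near) (simp add: M_def power2_eq_square mult.assoc)
      show "\<bar>(4 * q) ^ 3 * x - 4 * ?b3 * p\<bar> < p"
        using Fk[OF *(5), of t y] by (intro near) (simp add: N_def M_def k_def x_def)
      \<comment> \<open>Since \<open>q\<close> divides \<open>M\<close>, only the last digit of a
        prefix matters modulo \<open>q\<close>.\<close>
      have c: "[q * w + s mod q = s] (mod q)" for w s by (simp add: cong_def)
      have "?b2 = q * (4 * ?b1) + t * y ^ 2 mod q"
        "?b3 = q * (16 * q * ?b1 + 4 * (t * y ^ 2 mod q)) + t * y ^ 3 mod q"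
        by (simp_all add: M_def algebra_simps)
      then have "[?b2 = t * y ^ 2] (mod q)" "[?b3 = t * y ^ 3] (mod q)"
        using c by metis+
      then show "cong3 q (?b1, ?b2, ?b3) (moment t y)" by (simp add: moment_def cong_def)
    qed
    then show "0 \<le> F (t, y, r) \<and> F (t, y, r) < p \<and> near_moment p q L (F (t, y, r))"
      using x by (simp add: x_def)
  qed
  ultimately have "card D \<le> card {x \<in> {0..<p}. near_moment p q L x}"
    by (intro card_inj_on_le[of F] finite_subset[of "{x \<in> {0..<p}. near_moment p q L x}" "{0..<p}"]) auto
  moreover have "int (card D) = (2 * L - 1) * (q - 1) * (p div (4 * q) ^ 3)"
    using L q0 p N by (simp add: D_def R_def card_cartesian_product N_def M_def pos_imp_zdiv_nonneg_iff)
  ultimately show ?thesis by linarith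
qed

section \<open>Schur-free sets with small independence number\<close>

lemma residue_ring_minus:
  assumes "m > 1"
  shows "a \<ominus>\<^bsub>residue_ring m\<^esub> b = (a - b) mod m"
proof -
  interpret residues m "residue_ring m" by (simp add: residues_def assms)
  show ?thesis by (simp add: a_minus_def res_add_eq res_neg_eq mod_simps)
qed

lemma schur_solution_free_near_moment:
  assumes p: "p > 1" and q: "prime q" "0 < L" "6 * L \<le> q"
  shows "schur_solution_free p {x \<in> {0..<int p}. near_moment (int p) q L x}"
proof -
  interpret residues "int p" "residue_ring (int p)" using p by (simp add: residues_def)
  show ?thesis
    using near_moment_sum_free[OF q, of "int p"] p
    by (auto simp: schur_solution_free_def Let_def residue_ring_minus res_add_eq res_carrier_eq
        res_zero_eq mod_diff_left_eq mod_eq_0_iff_dvd)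
qed

lemma independent_set_cayley_digraph:
  assumes p: "p > 1" and S: "independent_set (with_proj (cayley_digraph p A)) S"
  shows "S \<subseteq> {0..<int p}" "u \<in> S \<Longrightarrow> v \<in> S \<Longrightarrow> u \<noteq> v \<Longrightarrow> (v - u) mod int p \<notin> A"
proof -
  interpret residues "int p" "residue_ring (int p)" using p by (simp add: residues_def)
  show sub: "S \<subseteq> {0..<int p}"
    using S by (auto simp: independent_set_def cayley_digraph_def Let_def res_carrier_eq)
  assume uv: "u \<in> S" "v \<in> S" "u \<noteq> v"
  show "(v - u) mod int p \<notin> A"
  proof
    assume "(v - u) mod int p \<in> A"
    then have "(u, v) \<in> parcs (cayley_digraph p A)"
      using sub uv p by (auto simp: cayley_digraph_def Let_def res_carrier_eq residue_ring_minus)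
    then have "(u, v) \<in> parcs (mk_symmetric (with_proj (cayley_digraph p A)))"
      by (force simp: parcs_mk_symmetric)
    then have "u \<rightarrow>\<^bsub>with_proj (mk_symmetric (with_proj (cayley_digraph p A)))\<^esub> v"
      by (force simp: arcs_ends_conv)
    then show False using S uv by (auto simp: independent_set_def)
  qed
qed

lemma independence_number_le:
  assumes "finite (verts G)" "\<And>S. independent_set G S \<Longrightarrow> card S \<le> n"
  shows "independence_number G \<le> n"
proof -
  have "finite {S. independent_set G S}"
    by (rule finite_subset[of _ "Pow (verts G)"]) (use assms(1) in \<open>auto simp: independent_set_def\<close>)
  moreover have "independent_set G {}" by (simp add: independent_set_def)
  ultimately show ?thesis
    unfolding independence_number_def using assms(2) by (subst Max_le_iff) auto
qed

lemma independence_number_near_moment_le: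
  assumes p: "p > 1" and q: "prime q" "0 < L" "6 * L \<le> q"
    and a: "\<And>n. int n * (q - 1) * L \<le> 3 * q ^ 4 \<Longrightarrow> n \<le> a"
  shows "independence_number (with_proj (cayley_digraph p {x \<in> {0..<int p}. near_moment (int p) q L x}))
    \<le> 64 * (a * nat (int p div (4 * q) ^ 3 + 1))"
proof (rule independence_number_le)
  show "finite (verts (with_proj (cayley_digraph p {x \<in> {0..<int p}. near_moment (int p) q L x})))"
    by (simp add: cayley_digraph_def Let_def residue_ring_def)
  fix S assume S: "independent_set (with_proj (cayley_digraph p {x \<in> {0..<int p}. near_moment (int p) q L x})) S"
  show "card S \<le> 64 * (a * nat (int p div (4 * q) ^ 3 + 1))"
  proof (rule independent_near_moment_bound[OF _ q])
    show "S \<subseteq> {0..<int p}" by (rule independent_set_cayley_digraph(1)[OF p S])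
    show "\<not> near_moment (int p) q L (v - u)" if "u \<in> S" "v \<in> S" "u \<noteq> v" for u v
      using independent_set_cayley_digraph(2)[OF p S that] p near_moment_mod[of "int p" q L "v - u"] by simp
    show "card T \<le> a" if "T \<subseteq> box3 q"
      "\<And>u v t y. u \<in> T \<Longrightarrow> v \<in> T \<Longrightarrow> 2 * L < t \<Longrightarrow> t < 4 * L \<Longrightarrow> 0 < y \<Longrightarrow> y < q \<Longrightarrow>
                  \<not> cong3 q (v - u - moment t y) 0" for T
      by (rule a[OF independent_box3_bound[OF q(1) q(2) _ that]]) (use q in auto)
  qed (use p in auto)
qed

text \<open>\<open>Sup\<close> on the naturals is an upper bound only for bounded sets; here
  \<open>p\<close> is a bound, as \<open>A\<close> consists of residues.\<close>

lemma schur_D_ge: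
  assumes "schur_solution_free p A"
    and "real (independence_number (with_proj (cayley_digraph p A))) \<le> \<epsilon> * real p"
  shows "card A \<le> schur_D \<epsilon> p"
  unfolding schur_D_def
proof (rule cSup_upper)
  show "bdd_above {card A |A. schur_solution_free p A \<and>
      real (independence_number (with_proj (cayley_digraph p A))) \<le> \<epsilon> * real p}"
  proof (rule bdd_aboveI)
    fix n assume "n \<in> {card A |A. schur_solution_free p A \<and>
      real (independence_number (with_proj (cayley_digraph p A))) \<le> \<epsilon> * real p}"
    then obtain A where "n = card A" "A \<subseteq> {0..int p - 1}"
      by (auto simp: schur_solution_free_def Let_def residue_ring_def)
    then show "n \<le> p" using card_mono[of "{0..int p - 1}" A] by simp
  qed
qed (use assms in blast)

text \<open>The worst case is \<open>q = 6 * k + 5\<close>, which needs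
  \<open>k \<ge> 5\<close>.\<close>

lemma le_7_mult_div_6:
  fixes q :: nat
  assumes "30 \<le> q"
  shows "q \<le> 7 * (q div 6)"
  using assms by presburger

text \<open>With \<open>L = q div 6\<close> the independence number is at most
  \<open>42 * p / q + 2688 * q ^ 2\<close>. The assumptions on \<open>\<epsilon> * q\<close> and
  \<open>\<epsilon> * p\<close> make each summand at most half of
  \<open>\<epsilon> * p\<close>.\<close>

lemma schur_D_ge_real:
  fixes q p :: nat and \<epsilon> :: real
  assumes q: "prime q" "1024 < q" "1024 \<le> \<epsilon> * real q"
    and p: "128 * real q ^ 3 \<le> real p" "5376 * real q ^ 2 \<le> \<epsilon> * real p"
  shows "real p / (1792 * real q) \<le> real (schur_D \<epsilon> p)"
proof -
  define L where "L = q div 6"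
  have L: "q \<le> 7 * L" "0 < L" "6 * L \<le> q" using le_7_mult_div_6 q(2) by (auto simp: L_def)
  have q0: "real q > 1024" using q(2) by simp
  have "1 < real q ^ 3" using q0 by (intro one_less_power) auto
  then have p1: "p > 1" using p(1) by linarith
  let ?A = "{x \<in> {0..<int p}. near_moment (int p) (int q) (int L) x}"
  define d where "d = int p div (4 * int q) ^ 3"
  have d: "real_of_int d \<le> real p / (64 * real q ^ 3)" "real p / (64 * real q ^ 3) - 1 \<le> real_of_int d"
  proof -
    have N: "real_of_int ((4 * int q) ^ 3) = 64 * real q ^ 3" by (simp add: power_mult_distrib)
    show "real_of_int d \<le> real p / (64 * real q ^ 3)"
      unfolding d_def using real_of_int_div4[of "int p" "(4 * int q) ^ 3"] unfolding N by simp
    have "real p / (64 * real q ^ 3) < real_of_int d + 1"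
      using floor_divide_of_int_eq[where 'a = real, of "int p" "(4 * int q) ^ 3"]
        floor_correct[of "real p / (64 * real q ^ 3)"] unfolding N d_def by simp
    then show "real p / (64 * real q ^ 3) - 1 \<le> real_of_int d" by linarith
  qed
  have d0: "d \<ge> 0" by (simp add: d_def pos_imp_zdiv_nonneg_iff q prime_gt_0_nat)
  \<comment> \<open>The constant is \<open>3 * 2 * 7\<close>, from
    \<open>q \<le> 2 * (q - 1)\<close> and \<open>q \<le> 7 * L\<close>.\<close>
  have card_bound: "n \<le> 42 * q ^ 2" if "int n * (int q - 1) * int L \<le> 3 * int q ^ 4" for n
  proof -
    have "int n * int q ^ 2 \<le> int n * ((2 * (int q - 1)) * (7 * int L))"
      unfolding power2_eq_square using q(2) L by (intro mult_left_mono mult_mono) auto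
    also have "\<dots> = 14 * (int n * (int q - 1) * int L)" by simp
    also have "\<dots> \<le> 14 * (3 * int q ^ 4)" using that by (intro mult_left_mono) auto
    also have "\<dots> = (42 * int q ^ 2) * int q ^ 2" by (simp add: power4_eq_xxxx power2_eq_square)
    finally have "int n \<le> 42 * int q ^ 2" using q(2) by simp
    then have "int n \<le> int (42 * q ^ 2)" by simp
    then show ?thesis by (simp only: of_nat_le_iff)
  qed
  have "independence_number (with_proj (cayley_digraph p ?A)) \<le> 64 * (42 * q ^ 2 * nat (d + 1))"
    unfolding d_def by (rule independence_number_near_moment_le[OF p1]) (use q L card_bound in auto)
  then have "real (independence_number (with_proj (cayley_digraph p ?A))) \<le> real (64 * (42 * q ^ 2 * nat (d + 1)))"
    by (simp only: of_nat_le_iff)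
  also have "\<dots> = 2688 * real q ^ 2 * (real_of_int d + 1)" using d0 by simp
  also have "\<dots> \<le> 2688 * real q ^ 2 * (real p / (64 * real q ^ 3) + 1)"
    using d(1) by (intro mult_left_mono) auto
  also have "\<dots> = 42 * real p / real q + 2688 * real q ^ 2"
    using q0 by (simp add: field_simps power2_eq_square power3_eq_cube)
  also have "42 * real p / real q \<le> \<epsilon> * real p / 2"
  proof -
    have "84 * real p \<le> (\<epsilon> * real q) * real p" using q(3) by (intro mult_right_mono) auto
    then show ?thesis using q0 by (simp add: field_simps)
  qed
  finally have "real (independence_number (with_proj (cayley_digraph p ?A))) \<le> \<epsilon> * real p"
    using p(2) by linarith
  moreover have "schur_solution_free p ?A"
    using schur_solution_free_near_moment[OF p1, of "int q" "int L"] q L by simp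
  ultimately have D: "card ?A \<le> schur_D \<epsilon> p" by (intro schur_D_ge)
  have "real p / (1792 * real q) = (real q / 7) * (real q / 2) * (real p / (128 * real q ^ 3))"
    using q0 by (simp add: field_simps power3_eq_cube)
  also have "\<dots> \<le> (2 * real L - 1) * (real q - 1) * real_of_int d"
  proof (intro mult_mono)
    show "real q / 7 \<le> 2 * real L - 1" using L by linarith
    show "real q / 2 \<le> real q - 1" using q0 by simp
    \<comment> \<open>Since \<open>p / (64 * q ^ 3)\<close> is at least 2, rounding it down loses at
      most half.\<close>
    have "1 \<le> real p / (128 * real q ^ 3)" using p(1) q0 by (simp add: field_simps)
    then show "real p / (128 * real q ^ 3) \<le> real_of_int d" using d(2) by (simp add: field_simps)
  qed (use L q0 in auto)
  also have "\<dots> = real_of_int ((2 * int L - 1) * (int q - 1) * d)" by simp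
  also have "\<dots> \<le> real_of_int (int (card ?A))"
    unfolding d_def of_int_le_iff by (rule near_moment_card_ge) (use p1 q L in auto)
  finally show ?thesis using D by simp
qed

text \<open>The least power of four that is at least \<open>X\<close> is at most
  \<open>4 * X\<close>, and the next prime gap bound costs another factor 4. As
  \<open>1024 = 4 ^ 5\<close>, the exponent is large enough for
  \<open>prime_between_powers_of_4\<close>.\<close>

lemma exists_prime_scale:
  fixes X :: real
  assumes "X \<ge> 1024"
  shows "\<exists>q::nat. prime q \<and> X < real q \<and> real q \<le> 16 * X"
proof -
  obtain k where "X \<le> 4 ^ k" using real_arch_pow[of 4 X] by (auto intro: less_imp_le)
  define j where "j = (LEAST k. X \<le> 4 ^ k)"
  have j: "X \<le> 4 ^ j" unfolding j_def by (rule LeastI) fact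
  have "(4::real) ^ 5 \<le> 4 ^ j" using j assms by simp
  then have j5: "j \<ge> 5" by (simp only: power_increasing_iff)
  then obtain i where i: "j = Suc i" by (cases j) auto
  have "\<not> X \<le> 4 ^ i" using not_less_Least[of i "\<lambda>k. X \<le> 4 ^ k"] i by (simp add: j_def)
  then have j4: "4 ^ j \<le> 4 * X" by (simp add: i)
  obtain q :: nat where q: "prime q" "4 ^ j < q" "q \<le> 4 ^ Suc j"
    using prime_between_powers_of_4[OF j5] by blast
  have "4 ^ j < real q" using q(2) by simp
  moreover have "real q \<le> real (4 ^ Suc j)" using q(3) by (simp only: of_nat_le_iff)
  then have "real q \<le> 4 * 4 ^ j" by simp
  ultimately have "X < real q" "real q \<le> 16 * X" using j j4 by linarith+
  then show ?thesis using q(1) by blast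
qed

text \<open>The infinitude of primes, in the form that \<open>le_Limsup\<close> requires.\<close>

lemma primes_filter_neq_bot: "inf sequentially (principal {p::nat. prime p}) \<noteq> bot"
proof
  assume "inf sequentially (principal {p::nat. prime p}) = bot"
  then have "\<forall>\<^sub>F p::nat in sequentially. \<not> prime p"
    using eventually_inf_principal[of "\<lambda>_. False" sequentially "{p::nat. prime p}"] by simp
  then show False using bigger_prime by (auto simp: eventually_sequentially) (meson less_imp_le)
qed

theorem theorem4p2:
  shows "\<exists>c::real. c > 0 \<and> (\<forall>\<epsilon>::real. 0 < \<epsilon> \<and> \<epsilon> \<le> 1 \<longrightarrow> schur_d \<epsilon> \<ge> ereal (c * \<epsilon>))"
proof (intro exI[of _ "1 / 30000000"] conjI allI impI)
  fix \<epsilon> :: real assume \<epsilon>: "0 < \<epsilon> \<and> \<epsilon> \<le> 1"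
  have "1024 \<le> 1024 / \<epsilon>" using \<epsilon> by (simp add: field_simps)
  then obtain q :: nat where q: "prime q" "1024 / \<epsilon> < real q" "real q \<le> 16 * (1024 / \<epsilon>)"
    using exists_prime_scale by blast
  have q0: "real q > 1024" using q(2) \<open>1024 \<le> 1024 / \<epsilon>\<close> by linarith
  \<comment> \<open>\<open>q\<close> depends on \<open>\<epsilon>\<close> alone, so both size
    conditions of \<open>schur_D_ge_real\<close> hold from a fixed threshold on.\<close>
  define P where "P = max (128 * real q ^ 3) (5376 * real q ^ 2 / \<epsilon>)"
  have ge: "ereal (1 / 30000000 * \<epsilon>) \<le> ereal (real (schur_D \<epsilon> p) / real p)" if "P \<le> real p" for p
  proof -
    have p: "128 * real q ^ 3 \<le> real p" "5376 * real q ^ 2 \<le> \<epsilon> * real p"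
      using that \<epsilon> by (simp_all add: P_def field_simps)
    have p0: "real p > 0" using p(1) q0 by (smt (verit) zero_less_power)
    have "real p / (1792 * real q) \<le> real (schur_D \<epsilon> p)"
      by (rule schur_D_ge_real[OF q(1) _ _ p]) (use q(2) q0 \<epsilon> in \<open>simp_all add: field_simps\<close>)
    then have "1 / (1792 * real q) \<le> real (schur_D \<epsilon> p) / real p"
      using p0 by (simp add: field_simps)
    \<comment> \<open>The upper bound on \<open>q\<close> gives
      \<open>1792 * 16 * 1024 = 29360128\<close>, rounded up here.\<close>
    moreover have "1 / 30000000 * \<epsilon> \<le> 1 / (1792 * real q)"
      using q(3) q0 \<epsilon> by (simp add: field_simps)
    ultimately show ?thesis by simp
  qed
  have "\<forall>\<^sub>F p in sequentially. P \<le> real p"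
    by (rule eventually_sequentiallyI[of "nat \<lceil>P\<rceil>"]) linarith
  then have "\<forall>\<^sub>F p in inf sequentially (principal {p. prime p}). ereal (1 / 30000000 * \<epsilon>) \<le> ereal (real (schur_D \<epsilon> p) / real p)"
    unfolding eventually_inf_principal by eventually_elim (use ge in blast)
  then show "schur_d \<epsilon> \<ge> ereal (1 / 30000000 * \<epsilon>)"
    unfolding schur_d_def by (rule le_Limsup[OF primes_filter_neq_bot])
qed simp

end
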